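(* Let $\mathfrak{g}$ be the affine Kac--Moody algebra of type $A_1^{(1)}$ and let $u\in\mathbb{Z}_{>1}$. Let $\Lambda=m\Lambda_0+\frac{j\alpha}{2}\in P_+$ and let $\lambda=m'\Lambda_0+\frac{j'\alpha}{2}\in\dot P_+$. 1. If there exists $b\in\mathbb{C}$ such that $(\Lambda,\lambda+b\delta)\in\Gamma(\mathfrak{g},\mathfrak{g}[u])$, then $j'-j\in2\mathbb{Z}$ and $m'=m$. 2. If $j'-j\in2\mathbb{Z}$, $m'=m$, and moreover either (a) $j\le j'\le um-j$ and $u$ is even; or (b) $j\le j'\le um-(m-j)$ and $u$ is odd, then $b_{\Lambda,\lambda,u}=b_{\Lambda,\lambda}$ (in particular $b_{\Lambda,\lambda,u}$ is defined).
   Context: Type $A_1^{(1)}$: $\mathfrak{g}$ is the affine Kac--Moody algebra over $\mathbb{C}$ with Cartan matrix $\begin{pmatrix}2&-2\\-2&2\end{pmatrix}$ (indices $0,1$), Cartan subalgebra $\mathfrak{h}$ with basis $h_0,h_1,d$, simple roots $\alpha_0,\alpha_1$ with $\alpha_i(h_j)=a_{ji}$, $\alpha_0(d)=1$, $\alpha_1(d)=0$. Put $\alpha=\alpha_1$, $\delta=\alpha_0+\alpha_1$, $K=h_0+h_1$; $\Lambda_0(h_0)=1$, $\Lambda_0(h_1)=\Lambda_0(d)=0$. Dominant integral weights: $P_+=\{m\Lambda_0+\frac{j\alpha}2\mid m,j\in\mathbb{Z},\ 0\le j\le m\}+\mathbb{C}\delta$. $L(\Lambda)$ is the irreducible highest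 weight $\mathfrak{g}$-module of highest weight $\Lambda$, and $P(\Lambda)$ is its set of $\mathfrak{h}$-weights. Winding subalgebra: $\mathfrak{g}[u]\subset\mathfrak{g}$ is the subalgebra $\mathbb{C}[t^u,t^{-u}]\otimes\mathfrak{sl}_2\oplus\mathbb{C}K\oplus\mathbb{C}d$ of $\mathfrak{g}=\mathbb{C}[t,t^{-1}]\otimes\mathfrak{sl}_2\oplus\mathbb{C}K\oplus\mathbb{C}d$. It is isomorphic to $\mathfrak{g}$, with Cartan subalgebra $\mathfrak{h}$, simple roots $\dot\alpha_0=\alpha_0+(u-1)\delta$, $\dot\alpha_1=\alpha_1$ and simple coroots $\dot h_0=h_0+(u-1)K$, $\dot h_1=h_1$. Its dominant integral weights are $\dot P_+=\{m'\Lambda_0+\frac{j'\alpha}2\mid um'\in\mathbb{Z},\ j'\in\mathbb{Z},\ 0\le j'\le um'\}+\mathbb{C}\delta$, and $\dot L(\lambda)$ is the irreducible integrable highest weight $\mathfrak{g}[u]$-module of highest weight $\lambda\in\dot P_+$. The restriction of $L(\Lambda)$ ($\Lambda\in P_+$) to $\mathfrak{g}[u]$ is a direct sum of modules $\dot L(\lambda)$ with finite multiplicities; $P_u(\Lambda)$ is the set of $\lambda\in\dot P_+$ such that $\dot L(\lambda)$ occurs, and $\Gamma(\mathfrak{g},\mathfrak{g}[u])=\{(\Lambda,\lambda)\in P_+\times\dot P_+\mid\lambda\in P_u(\Lambda)\}$. The numbers $b$: for $\lambda\in P(\Lambda)+\mathbb{C}\delta$, $b_{\Lambda,\lambda}$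 is the unique $b\in\mathbb{C}$ with $\lambda+b\delta\in P(\Lambda)$ and $\lambda+(b+n)\delta\notin P(\Lambda)$ for all integers $n>0$. For $\lambda\in P_u(\Lambda)+\mathbb{C}\delta$, $b_{\Lambda,\lambda,u}$ is the unique $b\in\mathbb{C}$ with $\lambda+b\delta\in P_u(\Lambda)$ and $\lambda+(b+n)\delta\notin P_u(\Lambda)$ for all integers $n>0$. *)

theory Defs
  imports "HOL-Analysis.Analysis" "HOL-Library.Poly_Mapping"
begin

text \<open>The Laurent polynomial ring in one variable \<open>t\<close> over the complex numbers is the group
  algebra of the integers: \<open>Poly_Mapping.single n c\<close> is the monomial \<open>c t\<^sup>n\<close>, and the library
  product on \<^typ>\<open>int \<Rightarrow>\<^sub>0 complex\<close> is convolution.\<close>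

type_synonym laurent = "int \<Rightarrow>\<^sub>0 complex"

text \<open>The derivation \<open>t (d/dt)\<close>.\<close>

definition euler :: "laurent \<Rightarrow> laurent" where
  "euler p = Poly_Mapping.mapp (\<lambda>n c. of_int n * c) p"

text \<open>The affine algebra in its loop realization: the tuple \<open>(a, b, c, k, s)\<close> stands for
  \<open>a \<otimes> e + b \<otimes> h + c \<otimes> f + k K + s d\<close>, where \<open>e, h, f\<close> is the standard basis of
  \<open>sl\<^sub>2\<close> with \<open>[e,f] = h\<close>, \<open>[h,e] = 2e\<close>, \<open>[h,f] = -2f\<close>.\<close>

type_synonym affine_sl2 = "laurent \<times> laurent \<times> laurent \<times> complex \<times> complex"

fun lie_scale :: "complex \<Rightarrow> affine_sl2 \<Rightarrow> affine_sl2" where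
  "lie_scale z (a, b, c, k, s) =
     (Poly_Mapping.single 0 z * a, Poly_Mapping.single 0 z * b, Poly_Mapping.single 0 z * c,
      z * k, z * s)"

text \<open>The bracket is determined by
  \<open>[p \<otimes> x, q \<otimes> y] = p q \<otimes> [x,y] + (x|y) Res((dp/dt) q) K\<close>, where \<open>(x|y) = tr(x y)\<close>
  (so \<open>(e|f) = 1\<close> and \<open>(h|h) = 2\<close>), \<open>[d, q \<otimes> y] = t (dq/dt) \<otimes> y\<close>, and \<open>K\<close> central.
  The residue of \<open>(dp/dt) q\<close> is the constant coefficient of \<open>euler p * q\<close>.\<close>

fun lie_bracket :: "affine_sl2 \<Rightarrow> affine_sl2 \<Rightarrow> affine_sl2" where
  "lie_bracket (a, b, c, k, s) (a', b', c', k', s') =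
     (2 * (b * a' - a * b')
        + Poly_Mapping.single 0 s * euler a' - Poly_Mapping.single 0 s' * euler a,
      a * c' - c * a'
        + Poly_Mapping.single 0 s * euler b' - Poly_Mapping.single 0 s' * euler b,
      2 * (c * b' - b * c')
        + Poly_Mapping.single 0 s * euler c' - Poly_Mapping.single 0 s' * euler c,
      Poly_Mapping.lookup (euler a * c' + euler c * a' + 2 * (euler b * b')) 0,
      0)"

definition K_elt :: affine_sl2 where "K_elt = (0, 0, 0, 1, 0)"
definition d_elt :: affine_sl2 where "d_elt = (0, 0, 0, 0, 1)"
definition h1_elt :: affine_sl2 where "h1_elt = (0, 1, 0, 0, 0)"
definition h0_elt :: affine_sl2 where "h0_elt = K_elt - h1_elt"

text \<open>The winding subalgebra \<open>g[u]\<close>, in which only powers of \<open>t\<^sup>u\<close> occur; \<open>g[1]\<close> is the whole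
  affine algebra.\<close>

definition winding :: "nat \<Rightarrow> affine_sl2 set" where
  "winding u = {(a, b, c, k, s).
     \<forall>p \<in> {a, b, c}. \<forall>n \<in> Poly_Mapping.keys p. int u dvd n}"

text \<open>The sum of the positive root spaces of \<open>g[u]\<close>. With respect to the simple roots
  \<open>\<alpha>\<^sub>0 + (u - 1)\<delta> = u\<delta> - \<alpha>\<close> and \<open>\<alpha>\<^sub>1 = \<alpha>\<close>, the positive roots are \<open>\<alpha> + un\<delta>\<close> for \<open>n \<ge> 0\<close>,
  and \<open>un\<delta>\<close> and \<open>-\<alpha> + un\<delta>\<close> for \<open>n \<ge> 1\<close>.\<close>

definition n_plus :: "nat \<Rightarrow> affine_sl2 set" where
  "n_plus u = winding u \<inter> {(a, b, c, k, s).
     Poly_Mapping.keys a \<subseteq> {0..} \<and> Poly_Mapping.keys b \<subseteq> {1..} \<and> Poly_Mapping.keys c \<subseteq> {1..} \<and>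
     k = 0 \<and> s = 0}"

text \<open>An element \<open>\<lambda>\<close> of the dual of the Cartan subalgebra is given by its values
  \<open>\<lambda>(h\<^sub>0), \<lambda>(h\<^sub>1), \<lambda>(d)\<close>, in this order.\<close>

type_synonym weight = "complex^3"

definition Lambda0 :: weight where "Lambda0 = vector [1, 0, 0]"
definition alpha0 :: weight where "alpha0 = vector [2, -2, 1]"
definition alpha1 :: weight where "alpha1 = vector [-2, 2, 0]"
definition delta :: weight where "delta = alpha0 + alpha1"

text \<open>\<open>level_weight m j\<close> is \<open>m\<Lambda>\<^sub>0 + j\<alpha>/2\<close>.\<close>

definition level_weight :: "real \<Rightarrow> int \<Rightarrow> weight" where
  "level_weight m j = complex_of_real m *s Lambda0 + (of_int j / 2) *s alpha1"

definition P_plus :: "weight set" where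
  "P_plus = {level_weight (of_int m) j + b *s delta | (m::int) j b. 0 \<le> j \<and> j \<le> m}"

definition P_plus_dot :: "nat \<Rightarrow> weight set" where
  "P_plus_dot u = {level_weight m j + b *s delta | m j b.
     of_nat u * m \<in> \<int> \<and> 0 \<le> j \<and> of_int j \<le> of_nat u * m}"

locale affine_module = vector_space scale
  for scale :: "complex \<Rightarrow> 'v::ab_group_add \<Rightarrow> 'v" +
  fixes act :: "affine_sl2 \<Rightarrow> 'v \<Rightarrow> 'v"
  assumes act_add_right: "act x (v + w) = act x v + act x w"
    and act_scale_right: "act x (scale z v) = scale z (act x v)"
    and act_add_left: "act (x + y) v = act x v + act y v"
    and act_scale_left: "act (lie_scale z x) v = scale z (act x v)"
    and act_bracket: "act (lie_bracket x y) v = act x (act y v) - act y (act x v)"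
begin

definition weight_space :: "weight \<Rightarrow> 'v set" where
  "weight_space lam = {v. act h0_elt v = scale (lam $ 1) v \<and> act h1_elt v = scale (lam $ 2) v \<and>
     act d_elt v = scale (lam $ 3) v}"

definition weights :: "weight set" where
  "weights = {lam. weight_space lam \<noteq> {0}}"

definition submodule :: "nat \<Rightarrow> 'v set \<Rightarrow> bool" where
  "submodule u W \<longleftrightarrow> subspace W \<and> (\<forall>x \<in> winding u. \<forall>v \<in> W. act x v \<in> W)"

definition irreducible_submodule :: "nat \<Rightarrow> 'v set \<Rightarrow> bool" where
  "irreducible_submodule u W \<longleftrightarrow> submodule u W \<and> W \<noteq> {0} \<and>
     (\<forall>U. submodule u U \<and> U \<subseteq> W \<longrightarrow> U = {0} \<or> U = W)"

text \<open>\<open>W\<close> is a \<open>g[u]\<close>-submodule generated by a highest weight vector of weight \<open>\<lambda>\<close>.\<close>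

definition highest_weight_submodule :: "nat \<Rightarrow> 'v set \<Rightarrow> weight \<Rightarrow> bool" where
  "highest_weight_submodule u W lam \<longleftrightarrow> submodule u W \<and>
     (\<exists>v \<in> W. v \<noteq> 0 \<and> v \<in> weight_space lam \<and> (\<forall>x \<in> n_plus u. act x v = 0) \<and>
        (\<forall>U. submodule u U \<and> v \<in> U \<longrightarrow> W \<subseteq> U))"

text \<open>An irreducible highest weight module is determined up to isomorphism by its highest weight,
  so this says that \<open>W\<close> is a copy of the irreducible \<open>g[u]\<close>-module of highest weight \<open>\<lambda>\<close>.\<close>

definition irreducible_highest_weight :: "nat \<Rightarrow> 'v set \<Rightarrow> weight \<Rightarrow> bool" where
  "irreducible_highest_weight u W lam \<longleftrightarrow>
     irreducible_submodule u W \<and> highest_weight_submodule u W lam"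

text \<open>The whole module is a realization of \<open>L(\<Lambda>)\<close>.\<close>

definition is_L :: "weight \<Rightarrow> bool" where
  "is_L Lam \<longleftrightarrow> irreducible_highest_weight 1 UNIV Lam"

text \<open>The highest weights of the irreducible \<open>g[u]\<close>-modules with dominant integral highest weight
  that occur in the restriction of the module to \<open>g[u]\<close>.\<close>

definition branching_weights :: "nat \<Rightarrow> weight set" where
  "branching_weights u =
     {lam \<in> P_plus_dot u. \<exists>W. irreducible_highest_weight u W lam}"

text \<open>The pairs \<open>(\<Lambda>, \<lambda>)\<close> of \<open>\<Gamma>(g, g[u])\<close> for which \<open>L(\<Lambda>)\<close> is realized by the present module.\<close>

definition Gamma :: "nat \<Rightarrow> (weight \<times> weight) set" where
  "Gamma u = {(Lam, lam) \<in> P_plus \<times> P_plus_dot u. is_L Lam \<and> lam \<in> branching_weights u}"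

end

text \<open>For \<open>S\<close> the set of weights of \<open>L(\<Lambda>)\<close>, respectively the set of branching weights, \<open>b_number S \<lambda>\<close>
  is \<open>b\<^bsub>\<Lambda>,\<lambda>\<^esub>\<close>, respectively \<open>b\<^bsub>\<Lambda>,\<lambda>,u\<^esub>\<close>. It is meaningful only when \<open>b_defined S \<lambda>\<close> holds.\<close>

definition is_b :: "weight set \<Rightarrow> weight \<Rightarrow> complex \<Rightarrow> bool" where
  "is_b S lam b \<longleftrightarrow> lam + b *s delta \<in> S \<and> (\<forall>n::int. n > 0 \<longrightarrow> lam + (b + of_int n) *s delta \<notin> S)"

definition b_defined :: "weight set \<Rightarrow> weight \<Rightarrow> bool" where
  "b_defined S lam \<longleftrightarrow> (\<exists>!b. is_b S lam b)"

definition b_number :: "weight set \<Rightarrow> weight \<Rightarrow> complex" where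
  "b_number S lam = (THE b. is_b S lam b)"

end

theory Submission
  imports Defs
begin

text \<open>The weights of the highest weight module of level \<open>m\<close> and highest weight \<open>m\<Lambda>\<^sub>0 + j\<alpha>/2\<close> lie
  on or below a concave polygon: over the interval from \<open>j\<close> to \<open>2m - j\<close> the bound drops with slope 1,
  because weights are \<open>\<Lambda>\<close> minus a sum of simple roots, and the spectral flow automorphism carries the
  module to one with \<open>j\<close> replaced by \<open>m - j\<close> while it shifts the slopes by one. For \<open>\<lambda>\<close> in the range of
  the theorem the polygon drops with slope at least 1 to the right and at most \<open>u - 1\<close> to the left of
  \<open>\<lambda>\<close>, so that for the maximal weight \<open>\<mu> = \<lambda> + b\<delta>\<close> neither \<open>\<mu> + \<alpha>\<close> nor \<open>\<mu> + u\<delta> - \<alpha>\<close> is a weight. Every vector of weight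
  \<open>\<mu>\<close> is therefore singular for \<open>g[u]\<close>. It generates an irreducible submodule: the real root vectors of
  \<open>g[u]\<close> act locally nilpotently, so a further singular vector would have dominant weight, and two
  dominant weights that differ by a nonzero sum of positive roots have different Casimir eigenvalues.\<close>

section \<open>Modules of fixed level\<close>

text \<open>\<open>E n\<close>, \<open>H n\<close>, \<open>F n\<close> are the actions of \<open>e\<close>, \<open>h\<close>, \<open>f\<close> times \<open>t\<^sup>n\<close>, \<open>D\<close> is the action of
  \<open>d\<close>, and \<open>K\<close> acts as the scalar \<open>m\<close>. In this form twisting a module by an automorphism, or
  restricting it to \<open>g[u]\<close>, only reindexes the modes.\<close>

locale loop_module = vector_space scale
  for scale :: "complex \<Rightarrow> 'v::ab_group_add \<Rightarrow> 'v" +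
  fixes E H F :: "int \<Rightarrow> 'v \<Rightarrow> 'v" and D :: "'v \<Rightarrow> 'v" and m :: complex
  assumes linear_E: "module_hom scale scale (E n)"
    and linear_H: "module_hom scale scale (H n)"
    and linear_F: "module_hom scale scale (F n)"
    and linear_D: "module_hom scale scale D"
    and E_E: "E r (E s x) = E s (E r x)"
    and F_F: "F r (F s x) = F s (F r x)"
    and E_F: "E r (F s x) = F s (E r x) + H (r + s) x + scale (if r + s = 0 then of_int r * m else 0) x"
    and H_E: "H r (E s x) = E s (H r x) + scale 2 (E (r + s) x)"
    and H_F: "H r (F s x) = F s (H r x) - scale 2 (F (r + s) x)"
    and H_H: "H r (H s x) = H s (H r x) + scale (if r + s = 0 then 2 * of_int r * m else 0) x"
    and D_E: "D (E r x) = E r (D x) + scale (of_int r) (E r x)"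
    and D_H: "D (H r x) = H r (D x) + scale (of_int r) (H r x)"
    and D_F: "D (F r x) = F r (D x) + scale (of_int r) (F r x)"
begin

lemmas linear_simps [simp] =
  linear_E[THEN module_hom.add] linear_E[THEN module_hom.scale] linear_E[THEN module_hom.zero]
  linear_E[THEN module_hom.diff] linear_E[THEN module_hom.neg]
  linear_H[THEN module_hom.add] linear_H[THEN module_hom.scale] linear_H[THEN module_hom.zero]
  linear_H[THEN module_hom.diff] linear_H[THEN module_hom.neg]
  linear_F[THEN module_hom.add] linear_F[THEN module_hom.scale] linear_F[THEN module_hom.zero]
  linear_F[THEN module_hom.diff] linear_F[THEN module_hom.neg]
  linear_D[THEN module_hom.add] linear_D[THEN module_hom.scale] linear_D[THEN module_hom.zero]
  linear_D[THEN module_hom.diff] linear_D[THEN module_hom.neg]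

definition wt_space :: "complex \<Rightarrow> complex \<Rightarrow> 'v set" where
  "wt_space p q = {x. H 0 x = scale p x \<and> D x = scale q x}"

definition stable :: "'v set \<Rightarrow> bool" where
  "stable U \<longleftrightarrow> subspace U \<and> (\<forall>x \<in> U. D x \<in> U \<and> (\<forall>n. E n x \<in> U \<and> H n x \<in> U \<and> F n x \<in> U))"

text \<open>\<open>E 0\<close> and \<open>F 1\<close> are the Chevalley generators e_1 and e_0; by
  \<open>singular_imp\<close> they control all positive root vectors.\<close>

definition singular :: "'v \<Rightarrow> bool" where
  "singular x \<longleftrightarrow> E 0 x = 0 \<and> F 1 x = 0"

text \<open>The operators \<open>F 0\<close> and \<open>E (-1)\<close> are the Chevalley generators \<open>f\<^sub>1\<close> and \<open>f\<^sub>0\<close>;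
  \<open>a\<close> and \<open>c\<close> count how often they occur.\<close>

inductive lowered :: "'v \<Rightarrow> nat \<Rightarrow> nat \<Rightarrow> 'v \<Rightarrow> bool" for v where
  base: "lowered v 0 0 v"
| F0: "lowered v a c x \<Longrightarrow> lowered v (Suc a) c (F 0 x)"
| E1: "lowered v a c x \<Longrightarrow> lowered v a (Suc c) (E (-1) x)"

definition generated :: "'v \<Rightarrow> 'v set" where
  "generated v = span {x. \<exists>a c. lowered v a c x}"

section \<open>The submodule generated by a singular vector\<close>

lemma subspace_wt_space: "subspace (wt_space p q)"
  by (rule subspaceI) (auto simp: wt_space_def algebra_simps)

lemma wt_space_E: "x \<in> wt_space p q \<Longrightarrow> E n x \<in> wt_space (p + 2) (q + of_int n)"
  by (simp add: wt_space_def H_E D_E scale_left_distrib)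

lemma wt_space_F: "x \<in> wt_space p q \<Longrightarrow> F n x \<in> wt_space (p - 2) (q + of_int n)"
  by (simp add: wt_space_def H_F D_F scale_left_distrib scale_left_diff_distrib)

lemma lowered_wt_space:
  assumes "v \<in> wt_space p q" "lowered v a c x"
  shows "x \<in> wt_space (p - 2 * of_nat a + 2 * of_nat c) (q - of_nat c)"
  using assms(2)
proof induction
  case base
  show ?case using assms(1) by simp
next
  case (F0 a c x)
  from wt_space_F[OF F0.IH, of 0] show ?case by (simp add: algebra_simps)
next
  case (E1 a c x)
  from wt_space_E[OF E1.IH, of "-1"] show ?case by (simp add: algebra_simps)
qed

lemma subspace_vimage:
  assumes "module_hom scale scale T" "subspace S"
  shows "subspace {x. T x \<in> S}"
  using assms(2)
  by (intro subspaceI)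
    (simp_all add: module_hom.add[OF assms(1)] module_hom.scale[OF assms(1)] module_hom.zero[OF assms(1)]
      subspace_0 subspace_add subspace_scale)

lemma span_induct_linear:
  assumes "x \<in> span S" "module_hom scale scale T" "subspace U" "\<And>y. y \<in> S \<Longrightarrow> T y \<in> U"
  shows "T x \<in> U"
  using span_minimal[of S "{x. T x \<in> U}"] assms subspace_vimage by blast

lemma subspace_generated: "subspace (generated v)"
  by (simp add: generated_def)

lemma lowered_in_generated: "lowered v a c x \<Longrightarrow> x \<in> generated v"
  unfolding generated_def by (auto intro: span_base)

lemma generated_base: "v \<in> generated v"
  by (rule lowered_in_generated[OF lowered.base])

text \<open>The bracket of \<open>E 0\<close> and \<open>F 1\<close> is \<open>H 1\<close>, so
  \<open>H 1\<close> kills \<open>v\<close>; bracketing with \<open>H 1\<close> raises the index of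
  \<open>E\<close> and \<open>F\<close> by one.\<close>

lemma singular_imp:
  assumes "singular v"
  shows "E (int n) v = 0" "F (int (Suc n)) v = 0" "H (int (Suc n)) v = 0"
proof -
  have H1: "H 1 v = 0"
    using E_F[of 0 1 v] assms by (simp add: singular_def)
  show E: "E (int n) v = 0" for n
  proof (induction n)
    case (Suc n)
    with H_E[of 1 "int n" v] H1 show ?case by simp
  qed (use assms in \<open>simp add: singular_def\<close>)
  show F: "F (int (Suc n)) v = 0" for n
  proof (induction n)
    case (Suc n)
    with H_F[of 1 "int (Suc n)" v] H1 show ?case by simp
  qed (use assms in \<open>simp add: singular_def\<close>)
  show "H (int (Suc n)) v = 0"
    using E_F[of 0 "int (Suc n)" v] F[of n] assms by (simp add: singular_def)
qed

text \<open>Only \<open>E (-1)\<close> lowers the \<open>D\<close>-value, by one each time, so the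
  bound grows with \<open>c\<close> alone. This is what makes truncated Casimir sums exact.\<close>

lemma lowered_annihilated:
  assumes "singular v" "lowered v a c x" "int c < n"
  shows "E n x = 0 \<and> H n x = 0 \<and> F n x = 0"
  using assms(2,3)
proof (induction arbitrary: n)
  case base
  then have n: "n = int (Suc (nat (n - 1)))" by simp
  show ?case by (subst (1 2 3) n) (use singular_imp[OF assms(1)] in blast)
next
  case (F0 a c x)
  then have "0 < n" by simp
  with F0 show ?case by (simp add: E_F H_F F_F[of n])
next
  case (E1 a c x)
  \<comment> \<open>Commuting past \<open>E (-1)\<close> produces modes of index
    \<open>n - 1\<close>; \<open>1 < n\<close> rules out the central term.\<close>
  then have "1 < n" "int c < n - 1" by simp_all
  with E1.IH[of n] E1.IH[of "n - 1"] E_F[of "-1" n x] show ?case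
    by (simp add: H_E E_E[of n])
qed

text \<open>\<open>H 1\<close> and \<open>H (-1)\<close> are brackets of Chevalley generators, and
  bracketing with them moves the index of \<open>E\<close> and \<open>F\<close> one step up or
  down.\<close>

lemma stableI:
  assumes U: "subspace U"
    and "\<And>x. x \<in> U \<Longrightarrow> D x \<in> U" and H0: "\<And>x. x \<in> U \<Longrightarrow> H 0 x \<in> U"
    and E0: "\<And>x. x \<in> U \<Longrightarrow> E 0 x \<in> U" and F0: "\<And>x. x \<in> U \<Longrightarrow> F 0 x \<in> U"
    and E1: "\<And>x. x \<in> U \<Longrightarrow> E (-1) x \<in> U" and F1: "\<And>x. x \<in> U \<Longrightarrow> F 1 x \<in> U"
  shows "stable U"
proof -
  have H1: "H 1 x \<in> U" if "x \<in> U" for x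
    using E_F[of 0 1 x] subspace_diff[OF U E0[OF F1[OF that]] F1[OF E0[OF that]]] by simp
  have Hm1: "H (-1) x \<in> U" if "x \<in> U" for x
    using E_F[of "-1" 0 x] subspace_diff[OF U E1[OF F0[OF that]] F0[OF E1[OF that]]] by simp
  have half: "y \<in> U" if "scale 2 y \<in> U" for y
    using subspace_scale[OF U that, of "1/2"] by simp
  have E_step: "E (n + k) x \<in> U"
    if "\<And>x. x \<in> U \<Longrightarrow> E n x \<in> U" "\<And>x. x \<in> U \<Longrightarrow> H k x \<in> U" "x \<in> U" for n k x
  proof (rule half)
    have "H k (E n x) - E n (H k x) \<in> U" by (rule subspace_diff[OF U]) (simp_all add: that)
    then show "scale 2 (E (n + k) x) \<in> U" by (simp add: H_E[of k n x] add.commute)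
  qed
  have F_step: "F (n + k) x \<in> U"
    if "\<And>x. x \<in> U \<Longrightarrow> F n x \<in> U" "\<And>x. x \<in> U \<Longrightarrow> H k x \<in> U" "x \<in> U" for n k x
  proof (rule half)
    have "F n (H k x) - H k (F n x) \<in> U" by (rule subspace_diff[OF U]) (simp_all add: that)
    then show "scale 2 (F (n + k) x) \<in> U" by (simp add: H_F[of k n x] add.commute)
  qed
  have E: "\<forall>x \<in> U. E n x \<in> U" for n
  proof (induction n rule: int_induct[where k = 0])
    case (step1 i) with E_step[of i 1] H1 show ?case by simp
  next
    case (step2 i) with E_step[of i "-1"] Hm1 show ?case by simp
  qed (use E0 in simp)
  have F: "\<forall>x \<in> U. F n x \<in> U" for n
  proof (induction n rule: int_induct[where k = 0])
    case (step1 i) with F_step[of i 1] H1 show ?case by simp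
  next
    case (step2 i) with F_step[of i "-1"] Hm1 show ?case by simp
  qed (use F0 in simp)
  have "H n x \<in> U" if "x \<in> U" for n x
  proof (cases "n = 0")
    case False
    then have "H n x = E n (F 0 x) - F 0 (E n x)" by (simp add: E_F)
    with E F that subspace_diff[OF U] show ?thesis by simp
  qed (use H0 that in simp)
  with assms E F show ?thesis by (auto simp: stable_def)
qed

lemma stable_subspace: "stable U \<Longrightarrow> subspace U"
  by (simp add: stable_def)

text \<open>The raising generators commute with the lowering ones up to \<open>H 0\<close> and the
  scalar \<open>m\<close>, so they can be moved through a monomial to \<open>v\<close>, which they
  kill.\<close>

lemma stable_generated:
  assumes "singular v" and v: "v \<in> wt_space p q"
  shows "stable (generated v)"
proof -
  have ext: "T x \<in> generated v"
    if "module_hom scale scale T" "x \<in> generated v" "\<And>a c y. lowered v a c y \<Longrightarrow> T y \<in> generated v" for T x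
    using span_induct_linear[OF that(2)[unfolded generated_def] that(1) subspace_generated] that(3)
    by blast
  note U = subspace_generated[of v]
  have low: "F 0 x \<in> generated v" "E (-1) x \<in> generated v" if "x \<in> generated v" for x
    by (rule ext[OF linear_F that] ext[OF linear_E that];
        blast intro: lowered_in_generated lowered.F0 lowered.E1)+
  have H0_D: "H 0 y \<in> generated v" "D y \<in> generated v" if "lowered v a c y" for a c y
    using lowered_wt_space[OF v that] subspace_scale[OF U lowered_in_generated[OF that]]
    by (simp_all add: wt_space_def)
  have "E 0 y \<in> generated v" if "lowered v a c y" for a c y
    using that
  proof induction
    case base
    then show ?case using assms(1) subspace_0[OF U] by (simp add: singular_def)
  next
    case (F0 a c x)
    then show ?case using H0_D(1)[OF F0.hyps] by (simp add: E_F subspace_add[OF U] low)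
  qed (simp add: E_E[of 0 "-1"] low)
  moreover have "F 1 y \<in> generated v" if "lowered v a c y" for a c y
    using that
  proof induction
    case base
    then show ?case using assms(1) subspace_0[OF U] by (simp add: singular_def)
  next
    case (E1 a c x)
    have "F 1 (E (-1) x) = E (-1) (F 1 x) - H 0 x + scale m x"
      by (simp add: E_F)
    show ?case
      unfolding \<open>F 1 (E (-1) x) = _\<close>
      by (intro subspace_add[OF U] subspace_diff[OF U] subspace_scale[OF U] low E1.IH
          H0_D(1)[OF E1.hyps] lowered_in_generated[OF E1.hyps])
  qed (simp add: F_F[of 1 0] low)
  ultimately show ?thesis
    using H0_D low
    by (intro stableI[OF U]) (auto intro: ext[OF linear_D] ext[OF linear_H] ext[OF linear_E] ext[OF linear_F])
qed

lemma generated_minimal: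
  assumes "stable U" "v \<in> U"
  shows "generated v \<subseteq> U"
proof -
  have "x \<in> U" if "lowered v a c x" for a c x
    using that by induction (use assms in \<open>auto simp: stable_def\<close>)
  then show ?thesis
    unfolding generated_def using assms(1) by (intro span_minimal) (auto simp: stable_def)
qed

section \<open>Decomposition into weight vectors\<close>

text \<open>Applying \<open>H 0\<close> minus \<open>fst k\<close>, or \<open>D\<close> minus
  \<open>snd k\<close>, removes the summand of index \<open>k\<close>; every other summand is
  multiplied by a factor that is nonzero in at least one of the two cases.\<close>

lemma wt_components:
  assumes "finite I" and U: "subspace U"
    and inv: "\<And>x. x \<in> U \<Longrightarrow> H 0 x \<in> U" "\<And>x. x \<in> U \<Longrightarrow> D x \<in> U"
    and "\<And>i. i \<in> I \<Longrightarrow> z i \<in> wt_space (fst i) (snd i)" "sum z I \<in> U"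
  shows "\<forall>i \<in> I. z i \<in> U"
  using assms(1,5,6)
proof (induction arbitrary: z)
  case (insert k I)
  let ?S = "sum z (insert k I)"
  have z: "H 0 (z i) = scale (fst i) (z i)" "D (z i) = scale (snd i) (z i)" if "i \<in> insert k I" for i
    using insert.prems(1)[OF that] by (simp_all add: wt_space_def)
  have "H 0 ?S - scale (fst k) ?S = (\<Sum>i\<in>I. scale (fst i - fst k) (z i))"
    using insert.hyps z
    by (simp add: module_hom.sum[OF linear_H] scale_sum_right scale_left_diff_distrib sum_subtractf
        scale_right_distrib)
  moreover have "H 0 ?S - scale (fst k) ?S \<in> U"
    using insert.prems(2) U inv by (intro subspace_diff subspace_scale) auto
  ultimately have p: "\<forall>i\<in>I. scale (fst i - fst k) (z i) \<in> U"
    using insert.prems(1) by (intro insert.IH) (auto intro!: subspace_scale[OF subspace_wt_space])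
  have "D ?S - scale (snd k) ?S = (\<Sum>i\<in>I. scale (snd i - snd k) (z i))"
    using insert.hyps z
    by (simp add: module_hom.sum[OF linear_D] scale_sum_right scale_left_diff_distrib sum_subtractf
        scale_right_distrib)
  moreover have "D ?S - scale (snd k) ?S \<in> U"
    using insert.prems(2) U inv by (intro subspace_diff subspace_scale) auto
  ultimately have q: "\<forall>i\<in>I. scale (snd i - snd k) (z i) \<in> U"
    using insert.prems(1) by (intro insert.IH) (auto intro!: subspace_scale[OF subspace_wt_space])
  have unscale: "x \<in> U" if "scale c x \<in> U" "c \<noteq> 0" for c x
    using subspace_scale[OF U that(1), of "inverse c"] that(2) by simp
  have I: "\<forall>i\<in>I. z i \<in> U"
  proof
    fix i assume "i \<in> I"
    with insert.hyps have "fst i - fst k \<noteq> 0 \<or> snd i - snd k \<noteq> 0" using prod_eqI[of i k] by auto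
    then show "z i \<in> U" using p q \<open>i \<in> I\<close> unscale by blast
  qed
  have "z k = ?S - sum z I" using insert.hyps by simp
  then have "z k \<in> U"
    using subspace_diff[OF U insert.prems(2) subspace_sum[OF U]] I by metis
  with I show ?case by simp
qed simp

definition wt_span :: "(complex \<times> complex) set \<Rightarrow> 'v set" where
  "wt_span G = span (\<Union>i \<in> G. wt_space (fst i) (snd i))"

lemma wt_span_decompose:
  assumes "x \<in> wt_span G"
  obtains I z where "finite I" "I \<subseteq> G" "\<And>i. z i \<in> wt_space (fst i) (snd i)" "x = sum z I"
proof -
  let ?P = "\<lambda>x I z. finite I \<and> I \<subseteq> G \<and> (\<forall>i. z i \<in> wt_space (fst i) (snd i)) \<and>
    (\<forall>i. i \<notin> I \<longrightarrow> z i = 0) \<and> x = sum z I"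
  have zero: "0 \<in> wt_space p q" for p q by (rule subspace_0[OF subspace_wt_space])
  have "\<exists>I z. ?P x I z"
    using assms unfolding wt_span_def
  proof (induction rule: span_induct_alt)
    case base
    show ?case by (rule exI[of _ "{}"], rule exI[of _ "\<lambda>_. 0"]) (simp add: zero)
  next
    case (step c x y)
    from step(1) obtain k where k: "k \<in> G" "x \<in> wt_space (fst k) (snd k)" by auto
    from step(2) obtain I z where z: "?P y I z" by blast
    let ?z = "z(k := scale c x + z k)"
    have "sum ?z (insert k I) = scale c x + z k + sum ?z (I - {k})"
      using z by (simp add: sum.insert_remove)
    also have "sum ?z (I - {k}) = sum z (I - {k})" by (rule sum.cong) auto
    also have "scale c x + z k + sum z (I - {k}) = scale c x + sum z I"
    proof (cases "k \<in> I")
      case True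
      with z show ?thesis by (simp add: sum.remove[of I k z] add.assoc)
    next
      case False
      moreover from this z have "z k = 0" by blast
      ultimately show ?thesis by simp
    qed
    finally have "?P (scale c x + y) (insert k I) ?z"
      using z k by (auto intro!: subspace_add[OF subspace_wt_space] subspace_scale[OF subspace_wt_space])
    then show ?case by blast
  qed
  then show thesis using that by blast
qed

lemma wt_in_wt_span:
  assumes "x \<in> wt_span G" "x \<in> wt_space p q" "x \<noteq> 0"
  shows "(p, q) \<in> G"
proof (rule ccontr)
  assume not: "(p, q) \<notin> G"
  obtain I z where z: "finite I" "I \<subseteq> G" "\<And>i. z i \<in> wt_space (fst i) (snd i)" "x = sum z I"
    using wt_span_decompose[OF assms(1)] by blast
  let ?z = "z((p, q) := - x)"
  have "sum ?z I = sum z I" using z(2) not by (intro sum.cong) auto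
  then have "sum ?z (insert (p, q) I) = 0" using z not by (subst sum.insert) auto
  moreover have "?z i \<in> wt_space (fst i) (snd i)" for i
    using z(3) assms(2) subspace_neg[OF subspace_wt_space] by auto
  ultimately have "?z (p, q) \<in> {0}"
    using z(1) wt_components[of "insert (p, q) I" "{0}" ?z] by auto
  with assms(3) show False by simp
qed

lemma exists_wt_vector:
  assumes "x \<in> wt_span G" "x \<in> U" "x \<noteq> 0" "stable U"
  obtains p q y where "(p, q) \<in> G" "y \<in> U" "y \<in> wt_space p q" "y \<noteq> 0"
proof -
  obtain I z where z: "finite I" "I \<subseteq> G" "\<And>i. z i \<in> wt_space (fst i) (snd i)" "x = sum z I"
    using wt_span_decompose[OF assms(1)] by blast
  with assms have "\<forall>i\<in>I. z i \<in> U"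
    by (intro wt_components) (auto simp: stable_def)
  moreover from z(4) assms(3) obtain i where "i \<in> I" "z i \<noteq> 0" by (metis sum.neutral)
  ultimately show thesis using z that[of "fst i" "snd i" "z i"] by auto
qed

text \<open>In the values on h_1 and d, \<alpha>_1 is (2, 0) and \<alpha>_0 is (-2, 1); so
  \<open>a\<close> copies of \<alpha>_1 and \<open>c\<close> copies of \<alpha>_0 are
  subtracted.\<close>

definition lower_wts :: "complex \<Rightarrow> complex \<Rightarrow> (complex \<times> complex) set" where
  "lower_wts p q = {(p - 2 * of_nat a + 2 * of_nat c, q - of_nat c) | a c. True}"

lemma generated_subset_wt_span:
  assumes "v \<in> wt_space p q"
  shows "generated v \<subseteq> wt_span (lower_wts p q)"
  unfolding generated_def wt_span_def lower_wts_def
  using lowered_wt_space[OF assms] by (intro span_mono) force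

lemma generated_wt:
  assumes "v \<in> wt_space p q" "x \<in> generated v" "x \<in> wt_space p' q'" "x \<noteq> 0"
  obtains a c :: nat where "p' = p - 2 * of_nat a + 2 * of_nat c" "q' = q - of_nat c"
proof -
  have "(p', q') \<in> lower_wts p q"
    using generated_subset_wt_span[OF assms(1)] assms(2-4) by (blast intro: wt_in_wt_span)
  then show thesis using that by (auto simp: lower_wts_def)
qed

text \<open>Every nonempty lowering monomial has a weight other than \<open>(p, q)\<close>, so only
  a multiple of \<open>v\<close> is left.\<close>

lemma generated_top:
  assumes v: "v \<in> wt_space p q" and x: "x \<in> generated v" "x \<in> wt_space p q"
  obtains z where "x = scale z v"
proof -
  let ?G = "{(p - 2 * of_nat a + 2 * of_nat c, q - of_nat c) | a c :: nat. a \<noteq> 0 \<or> c \<noteq> 0}"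
  have "{x. \<exists>a c. lowered v a c x} \<subseteq> insert v (\<Union>i \<in> ?G. wt_space (fst i) (snd i))"
  proof clarify
    fix y a c assume y: "lowered v a c y" "y \<notin> (\<Union>i \<in> ?G. wt_space (fst i) (snd i))"
    have "a = 0 \<and> c = 0" using lowered_wt_space[OF v y(1)] y(2) by force
    with y(1) show "y = v" by (auto elim: lowered.cases)
  qed
  from span_mono[OF this] x(1)
  have "x \<in> span (insert v (\<Union>i \<in> ?G. wt_space (fst i) (snd i)))"
    by (auto simp: generated_def)
  then obtain k where k: "x - scale k v \<in> wt_span ?G"
    unfolding span_breakdown_eq wt_span_def by blast
  have "x - scale k v \<in> wt_space p q"
    by (intro subspace_diff subspace_scale subspace_wt_space v x)
  with wt_in_wt_span[OF k, of p q] have "x - scale k v = 0" by auto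
  then show thesis using that[of k] by simp
qed

section \<open>Strings for the subalgebra sl_2\<close>

lemma wt_space_F0_power:
  assumes "x \<in> wt_space p q"
  shows "(F 0 ^^ i) x \<in> wt_space (p - 2 * of_nat i) q"
proof (induction i)
  case (Suc i)
  from wt_space_F[OF this, of 0] show ?case by (simp add: algebra_simps)
qed (use assms in simp)

lemma E0_F0_power:
  assumes "E 0 x = 0" "x \<in> wt_space p q"
  shows "E 0 ((F 0 ^^ Suc i) x) = scale (of_nat (Suc i) * (p - of_nat i)) ((F 0 ^^ i) x)"
proof (induction i)
  case 0
  then show ?case using assms by (simp add: E_F wt_space_def)
next
  case (Suc i)
  have H: "H 0 ((F 0 ^^ Suc i) x) = scale (p - 2 * of_nat (Suc i)) ((F 0 ^^ Suc i) x)"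
    using wt_space_F0_power[OF assms(2), of "Suc i"] by (simp add: wt_space_def)
  have "E 0 ((F 0 ^^ Suc (Suc i)) x) = F 0 (E 0 ((F 0 ^^ Suc i) x)) + H 0 ((F 0 ^^ Suc i) x)"
    by (simp add: E_F)
  also have "\<dots> = scale (of_nat (Suc i) * (p - of_nat i) + (p - 2 * of_nat (Suc i))) ((F 0 ^^ Suc i) x)"
    by (simp only: Suc.IH H linear_simps scale_left_distrib) simp
  also have "of_nat (Suc i) * (p - of_nat i) + (p - 2 * of_nat (Suc i)) =
      of_nat (Suc (Suc i)) * (p - of_nat (Suc i))"
    by (simp add: algebra_simps)
  finally show ?case .
qed

text \<open>\<open>E 0\<close> leads back to the previous power with the factor (i + 1)(j - i),
  which is nonzero for i < j.\<close>

lemma F0_power_nonzero: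
  assumes "E 0 x = 0" "x \<in> wt_space (of_nat j) q" "x \<noteq> 0" "i \<le> j"
  shows "(F 0 ^^ i) x \<noteq> 0"
  using assms(4)
proof (induction i)
  case (Suc i)
  then show ?case using E0_F0_power[OF assms(1,2), of i]
    by (auto simp del: funpow.simps of_nat_Suc)
qed (use assms in simp)

text \<open>At the first vanishing power, \<open>E 0\<close> returns a zero multiple of a nonzero
  vector, so the factor (i + 1)(p - i) vanishes.\<close>

lemma F0_nilpotent_imp_dominant:
  assumes "E 0 x = 0" "x \<in> wt_space p q" "x \<noteq> 0" "(F 0 ^^ n) x = 0"
  shows "\<exists>i. p = of_nat i"
proof -
  define k where "k = (LEAST n. (F 0 ^^ n) x = 0)"
  have k: "(F 0 ^^ k) x = 0" unfolding k_def by (rule LeastI[of _ n]) fact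
  with assms(3) obtain i where i: "k = Suc i" by (cases k) auto
  then have "(F 0 ^^ i) x \<noteq> 0" using not_less_Least[of i "\<lambda>n. (F 0 ^^ n) x = 0"] k_def by simp
  moreover have "scale (of_nat (Suc i) * (p - of_nat i)) ((F 0 ^^ i) x) = 0"
    using E0_F0_power[OF assms(1,2), of i] k i by (simp del: funpow.simps of_nat_Suc)
  ultimately have "p = of_nat i" by (simp del: of_nat_Suc)
  then show ?thesis ..
qed

section \<open>The Casimir operator\<close>

text \<open>The term of index \<open>n\<close> of the Casimir operator. On vectors annihilated by all modes of large
  index, \<open>casimir N\<close> is the Casimir operator as soon as \<open>N\<close> is large.\<close>

definition casimir_term :: "int \<Rightarrow> 'v \<Rightarrow> 'v" where
  "casimir_term n x = E (- n) (F n x) + F (- n) (E n x) + scale (1 / 2) (H (- n) (H n x))"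

definition casimir :: "nat \<Rightarrow> 'v \<Rightarrow> 'v" where
  "casimir N x = scale (2 * (m + 2)) (D x) + scale (1 / 2) (H 0 (H 0 x)) + H 0 x + scale 2 (F 0 (E 0 x))
     + scale 2 (\<Sum>n = 1..N. casimir_term (int n) x)"

lemma F_E: "F s (E r x) = E r (F s x) - H (r + s) x - scale (if r + s = 0 then of_int r * m else 0) x"
  by (simp add: E_F)

text \<open>The term pairs a basis of sl_2 in degree \<open>- n\<close> with the dual basis in
  degree \<open>n\<close>, so it is invariant under the constant sl_2.\<close>

lemma casimir_term_F0:
  assumes "n \<noteq> 0"
  shows "casimir_term n (F 0 x) = F 0 (casimir_term n x)"
proof -
  have 1: "E (- n) (F n (F 0 x)) = F 0 (E (- n) (F n x)) + H (- n) (F n x)"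
    using assms by (simp add: F_F[of n 0] E_F)
  have 2: "F (- n) (E n (F 0 x)) = F 0 (F (- n) (E n x)) + F (- n) (H n x)"
    using assms by (simp add: E_F F_F[of "- n" 0])
  have 3: "H (- n) (H n (F 0 x)) = F 0 (H (- n) (H n x)) - scale 2 (F (- n) (H n x))
      - scale 2 (H (- n) (F n x))"
    by (simp add: H_F[of n 0] H_F[of "- n" 0])
  show ?thesis by (simp add: casimir_term_def 1 2 3 algebra_simps)
qed

lemma scale_4: "scale 4 x = scale 2 x + scale 2 x"
  by (simp flip: scale_left_distrib)

lemma casimir_F0: "casimir N (F 0 x) = F 0 (casimir N x)"
proof -
  have sum: "(\<Sum>n = 1..N. casimir_term (int n) (F 0 x)) = F 0 (\<Sum>n = 1..N. casimir_term (int n) x)"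
    unfolding module_hom.sum[OF linear_F] by (rule sum.cong) (auto simp: casimir_term_F0)
  have 1: "H 0 (F 0 x) = F 0 (H 0 x) - scale 2 (F 0 x)" by (simp add: H_F)
  have 2: "H 0 (H 0 (F 0 x)) = F 0 (H 0 (H 0 x)) - scale 4 (F 0 (H 0 x)) + scale 4 (F 0 x)"
    by (simp add: 1 H_F[of 0 0 "H 0 x"] scale_right_diff_distrib scale_4)
  have 3: "F 0 (E 0 (F 0 x)) = F 0 (F 0 (E 0 x)) + F 0 (H 0 x)"
    by (simp add: E_F)
  have "D (F 0 x) = F 0 (D x)" by (simp add: D_F)
  then show ?thesis
    unfolding casimir_def sum by (simp add: 2 3 scale_right_diff_distrib scale_right_distrib) (simp add: 1)
qed

text \<open>A single term does not commute with \<open>E (-1)\<close>, but the errors are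
  differences of consecutive indices and telescope in the sum.\<close>

lemma casimir_term_E1:
  assumes "n \<ge> 1"
  shows "casimir_term n (E (-1) x) = E (-1) (casimir_term n x)
    - (E (- n) (H (n - 1) x) - E (- n - 1) (H n x)) - (H (- 1 - n) (E n x) - H (- n) (E (n - 1) x))
    + scale (if n = 1 then m else 0) (E (-1) x)"
proof -
  have 1: "E (- n) (F n (E (-1) x)) = E (-1) (E (- n) (F n x)) - E (- n) (H (n - 1) x)
      + scale (if n = 1 then m else 0) (E (-1) x)"
    by (simp add: F_E[of n "-1"] E_E[of "- n" "-1"])
  have 2: "F (- n) (E n (E (-1) x)) = E (-1) (F (- n) (E n x)) - H (- 1 - n) (E n x)"
    using assms by (simp add: F_E[of "- n" "-1"] E_E[of n "-1"])
  have 3: "H (- n) (H n (E (-1) x)) = E (-1) (H (- n) (H n x)) + scale 2 (E (- n - 1) (H n x))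
      + scale 2 (H (- n) (E (n - 1) x))"
    by (simp add: H_E[of n "-1"] H_E[of "- n" "-1"])
  show ?thesis by (simp add: casimir_term_def 1 2 3 algebra_simps)
qed

lemma casimir_sum_E1:
  "(\<Sum>n = 1..Suc N. casimir_term (int n) (E (-1) x)) = E (-1) (\<Sum>n = 1..Suc N. casimir_term (int n) x)
    - E (-1) (H 0 x) + E (- int (Suc N) - 1) (H (int (Suc N)) x)
    - H (- 1 - int (Suc N)) (E (int (Suc N)) x) + H (-1) (E 0 x) + scale m (E (-1) x)"
proof (induction N)
  case (Suc N)
  define k where "k = int (Suc (Suc N))"
  have k: "k \<ge> 1" "k \<noteq> 1" "int (Suc N) = k - 1" by (simp_all add: k_def)
  have "- int (Suc N) - 1 = - k" "- 1 - int (Suc N) = - k" by (simp_all add: k_def)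
  with Suc.IH show ?case
    using casimir_term_E1[OF k(1), of x] k(2)
    unfolding sum.cl_ivl_Suc[of _ 1 "Suc N"] k(3) k_def[symmetric]
    by (simp add: k_def del: sum.cl_ivl_Suc)
qed (simp add: casimir_term_E1)

text \<open>The hypotheses on \<open>x\<close> remove the upper ends of the telescoped sum. The
  lower ends cancel against the other summands because the coefficient of \<open>D\<close> is twice
  the level plus the dual Coxeter number 2, that is \<open>2 * (m + 2)\<close>.\<close>

lemma casimir_E1:
  assumes "E (int N) x = 0" "H (int N) x = 0" "N \<ge> 1"
  shows "casimir N (E (-1) x) = E (-1) (casimir N x)"
proof -
  obtain N' where N: "N = Suc N'" using assms(3) by (cases N) auto
  have sum: "(\<Sum>n = 1..N. casimir_term (int n) (E (-1) x)) = E (-1) (\<Sum>n = 1..N. casimir_term (int n) x)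
    - E (-1) (H 0 x) + H (-1) (E 0 x) + scale m (E (-1) x)"
    using casimir_sum_E1[where N = N' and x = x] assms N by simp
  have 1: "H 0 (E (-1) x) = E (-1) (H 0 x) + scale 2 (E (-1) x)" by (simp add: H_E)
  have 2: "H 0 (H 0 (E (-1) x)) = E (-1) (H 0 (H 0 x)) + scale 4 (E (-1) (H 0 x)) + scale 4 (E (-1) x)"
    by (simp add: 1 H_E[of 0 "-1" "H 0 x"] scale_right_distrib scale_4)
  have 3: "F 0 (E 0 (E (-1) x)) = E (-1) (F 0 (E 0 x)) - H (-1) (E 0 x)"
    by (simp add: E_E[of 0 "-1"] F_E[of 0 "-1"])
  have 4: "D (E (-1) x) = E (-1) (D x) - E (-1) x" by (simp add: D_E)
  show ?thesis
    unfolding casimir_def sum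
    by (simp add: 2 3 4 scale_right_distrib scale_right_diff_distrib scale_left_distrib)
      (simp add: 1 scale_4 algebra_simps)
qed

text \<open>The terms of positive index vanish. The scalar is (\<lambda> | \<lambda> + 2 \<rho>) for
  the weight \<lambda> of level \<open>m\<close> with coordinates \<open>p\<close> and
  \<open>q\<close>.\<close>

lemma casimir_singular:
  assumes "singular x" "x \<in> wt_space p q"
  shows "casimir N x = scale (2 * (m + 2) * q + p\<^sup>2 / 2 + p) x"
proof -
  have "casimir_term (int n) x = 0" if n: "n \<in> {1..N}" for n
  proof -
    obtain k where "n = Suc k" using n not0_implies_Suc[of n] by auto
    then show ?thesis using singular_imp[OF assms(1)] by (simp add: casimir_term_def del: of_nat_Suc)
  qed
  then have "(\<Sum>n = 1..N. casimir_term (int n) x) = 0" by simp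
  then show ?thesis using assms
    by (simp add: casimir_def singular_def wt_space_def power2_eq_square algebra_simps)
qed

text \<open>The scalar passes from \<open>v\<close> to a monomial once \<open>N\<close> exceeds its
  \<open>c\<close>, because then \<open>casimir N\<close> commutes past all its factors. For a
  linear combination a common \<open>N\<close> is taken.\<close>

lemma casimir_generated:
  assumes "singular v" "v \<in> wt_space p q" "x \<in> generated v"
  shows "\<exists>N0. \<forall>N \<ge> N0. casimir N x = scale (2 * (m + 2) * q + p\<^sup>2 / 2 + p) x"
proof -
  let ?z = "2 * (m + 2) * q + p\<^sup>2 / 2 + p"
  have lowered: "casimir N y = scale ?z y" if "lowered v a c y" "c < N" for a c y N
    using that
  proof induction
    case base
    then show ?case by (simp add: casimir_singular[OF assms(1,2)])
  next
    case (F0 a c x)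
    then show ?case by (simp add: casimir_F0)
  next
    case (E1 a c x)
    then show ?case using lowered_annihilated[OF assms(1) E1.hyps, of "int N"]
      by (simp add: casimir_E1)
  qed
  have add: "casimir N (x + y) = casimir N x + casimir N y"
    and sc: "casimir N (scale c x) = scale c (casimir N x)" for N c x y
    by (simp_all add: casimir_def casimir_term_def algebra_simps sum.distrib scale_sum_right)
  show ?thesis
    using assms(3) unfolding generated_def
  proof (induction rule: span_induct_alt)
    case base
    have "casimir N 0 = 0" for N using sc[of N 0 0] by simp
    then show ?case by simp
  next
    case (step b x y)
    then obtain a c N0 where "lowered v a c x" "\<forall>N\<ge>N0. casimir N y = scale ?z y" by blast
    then show ?case using lowered
      by (intro exI[of _ "max N0 (Suc c)"]) (simp add: add sc algebra_simps)
  qed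
qed

section \<open>Twists and the winding subalgebra\<close>

text \<open>The reflection in \<open>\<alpha>\<^sub>1\<close>, the diagram automorphism exchanging the two simple roots, where
  \<open>y\<close> shifts the energy of the highest weight vector back to zero, and the isomorphism of \<open>g\<close> with
  \<open>g[u]\<close>.\<close>

lemma loop_module_swap: "loop_module scale F (\<lambda>n x. - H n x) E D m"
proof unfold_locales
  show "F r (E s x) = E s (F r x) + - H (r + s) x + scale (if r + s = 0 then of_int r * m else 0) x" for r s x
  proof (cases "r + s = 0")
    case True
    then have "s = - r" by simp
    then show ?thesis by (simp add: F_E)
  qed (simp add: F_E add.commute)
  show "- H r (- H s x) = - H s (- H r x) + scale (if r + s = 0 then 2 * of_int r * m else 0) x" for r s x
    using H_H[of r s x] by simp
qed (simp_all add: E_E F_F H_E H_F D_E D_H D_F scale_right_distrib)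

lemma loop_module_flip:
  "loop_module scale (\<lambda>n. F (n + 1)) (\<lambda>n x. scale (if n = 0 then m else 0) x - H n x) (\<lambda>n. E (n - 1))
     (\<lambda>x. D x + scale (1 / 2) (H 0 x) - scale y x) m"
proof unfold_locales
  show "F (r + 1) (E (s - 1) x) = E (s - 1) (F (r + 1) x) + (scale (if r + s = 0 then m else 0) x - H (r + s) x) +
      scale (if r + s = 0 then of_int r * m else 0) x" for r s x
  proof (cases "r + s = 0")
    case True
    then have "s = - r" by simp
    then show ?thesis by (simp add: F_E algebra_simps)
  qed (simp add: F_E add.commute)
  show "scale (if r = 0 then m else 0) (scale (if s = 0 then m else 0) x - H s x) -
      H r (scale (if s = 0 then m else 0) x - H s x) =
      scale (if s = 0 then m else 0) (scale (if r = 0 then m else 0) x - H r x) -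
      H s (scale (if r = 0 then m else 0) x - H r x) +
      scale (if r + s = 0 then 2 * of_int r * m else 0) x" for r s x
    using H_H[of r s x] by (simp add: scale_right_diff_distrib mult.commute)
  show "D (F (r + 1) x) + scale (1 / 2) (H 0 (F (r + 1) x)) - scale y (F (r + 1) x) =
      F (r + 1) (D x + scale (1 / 2) (H 0 x) - scale y x) + scale (of_int r) (F (r + 1) x)" for r x
    by (simp add: D_F H_F algebra_simps)
  show "D (E (r - 1) x) + scale (1 / 2) (H 0 (E (r - 1) x)) - scale y (E (r - 1) x) =
      E (r - 1) (D x + scale (1 / 2) (H 0 x) - scale y x) + scale (of_int r) (E (r - 1) x)" for r x
    by (simp add: D_E H_E algebra_simps)
  show "D (scale (if r = 0 then m else 0) x - H r x) + scale (1 / 2) (H 0 (scale (if r = 0 then m else 0) x - H r x)) -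
      scale y (scale (if r = 0 then m else 0) x - H r x) =
      scale (if r = 0 then m else 0) (D x + scale (1 / 2) (H 0 x) - scale y x) -
      H r (D x + scale (1 / 2) (H 0 x) - scale y x) +
      scale (of_int r) (scale (if r = 0 then m else 0) x - H r x)" for r x
    using H_H[of r 0 x] by (simp add: D_H algebra_simps)
qed (simp_all add: E_E F_F H_E H_F algebra_simps)

lemma loop_module_winding:
  assumes "u > 0"
  shows "loop_module scale (\<lambda>n. E (int u * n)) (\<lambda>n. H (int u * n)) (\<lambda>n. F (int u * n))
     (\<lambda>x. scale (1 / of_nat u) (D x)) (of_nat u * m)"
proof -
  have add: "int u * r + int u * s = int u * (r + s)" for r s
    by (rule distrib_left[symmetric])
  have zero: "int u * (r + s) = 0 \<longleftrightarrow> r + s = 0" for r s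
    unfolding mult_eq_0_iff using assms by simp
  show ?thesis
  proof unfold_locales
    show "E (int u * r) (F (int u * s) x) = F (int u * s) (E (int u * r) x) + H (int u * (r + s)) x +
        scale (if r + s = 0 then of_int r * (of_nat u * m) else 0) x" for r s x
      unfolding E_F[of "int u * r" "int u * s"] add zero by simp
    show "H (int u * r) (H (int u * s) x) = H (int u * s) (H (int u * r) x) +
        scale (if r + s = 0 then 2 * of_int r * (of_nat u * m) else 0) x" for r s x
      unfolding H_H[of "int u * r" "int u * s"] add zero by simp
    show "H (int u * r) (E (int u * s) x) = E (int u * s) (H (int u * r) x) + scale 2 (E (int u * (r + s)) x)"
      and "H (int u * r) (F (int u * s) x) = F (int u * s) (H (int u * r) x) - scale 2 (F (int u * (r + s)) x)" for r s x
      unfolding H_E[of "int u * r" "int u * s"] H_F[of "int u * r" "int u * s"] add by simp_all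
  qed (use assms in \<open>simp_all add: E_E F_F D_E D_H D_F scale_right_distrib\<close>)
qed

text \<open>A nonzero weight vector of \<open>U\<close> of least depth \<open>a + c\<close> is
  singular. Nilpotency makes its weight dominant, and equality of the Casimir scalars then forces it
  to be the weight of \<open>v\<close>.\<close>

lemma irreducible_generated:
  assumes v: "singular v" "v \<noteq> 0" "v \<in> wt_space (of_nat j) q0"
    and m: "m = of_nat M" "j \<le> M"
    and nilF: "\<And>x p q. x \<in> wt_space p q \<Longrightarrow> \<exists>n. (F 0 ^^ n) x = 0"
    and nilE: "\<And>x p q. x \<in> wt_space p q \<Longrightarrow> \<exists>n. (E (-1) ^^ n) x = 0"
    and U: "stable U" "U \<subseteq> generated v" "U \<noteq> {0}"
  shows "U = generated v"
proof -
  define wt where "wt a c = wt_space (of_nat j - 2 * of_nat a + 2 * of_nat c) (q0 - of_nat c)" for a c :: nat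
  define has where "has = (\<lambda>(a, c). \<exists>y \<in> U. y \<noteq> 0 \<and> y \<in> wt a c)"
  note sub = stable_subspace[OF U(1)]
  obtain x0 where x0: "x0 \<in> U" "x0 \<noteq> 0" using U(3) subspace_0[OF sub] by blast
  obtain p q y0 where "(p, q) \<in> lower_wts (of_nat j) q0" "y0 \<in> U" "y0 \<in> wt_space p q" "y0 \<noteq> 0"
    using exists_wt_vector[OF _ x0 U(1)] generated_subset_wt_span[OF v(3)] U(2) x0(1) by blast
  then have "\<exists>a c. has (a, c)" by (auto simp: has_def wt_def lower_wts_def)
  then obtain ac where "has ac" and min: "\<And>bd. has bd \<Longrightarrow> fst ac + snd ac \<le> fst bd + snd bd"
    using ex_has_least_nat[of has _ "\<lambda>(a, c). a + c"] by (metis case_prod_beta')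
  moreover obtain a c where ac: "ac = (a, c)" by (cases ac)
  ultimately obtain y where y: "y \<in> U" "y \<noteq> 0" "y \<in> wt a c" by (auto simp: has_def)
  \<comment> \<open>\<open>a'\<close> and \<open>c'\<close> are integers because they will be
    \<open>a - 1\<close> or \<open>c - 1\<close>, where \<open>a\<close> or \<open>c\<close> may be
    zero.\<close>
  have lower: False if z: "z \<in> U" "z \<noteq> 0" "z \<in> wt_space p q"
    and p: "p = of_nat j - 2 * of_int a' + 2 * of_int c'" "q = q0 - of_int c'" and less: "a' + c' < int a + int c"
    for z p q a' c'
  proof -
    obtain a2 c2 :: nat where "p = of_nat j - 2 * of_nat a2 + 2 * of_nat c2" "q = q0 - of_nat c2"
      using generated_wt[OF v(3) _ z(3,2)] U(2) z(1) by blast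
    with p z have c: "of_int c' = (of_nat c2 :: complex)" and a: "of_int a' = (of_nat a2 :: complex)"
      and has: "has (a2, c2)" by (auto simp: has_def wt_def)
    from c a have "c' = int c2" "a' = int a2" by (metis of_int_eq_iff of_int_of_nat_eq)+
    with less min[OF has] ac show False by simp
  qed
  have y': "y \<in> wt_space (of_nat j - 2 * of_nat a + 2 * of_nat c) (q0 - of_nat c)"
    using y(3) by (simp add: wt_def)
  have "E 0 y = 0"
  proof (rule ccontr)
    assume "E 0 y \<noteq> 0"
    with lower[OF _ _ wt_space_E[OF y', of 0], of "int a - 1" "int c"] U(1) y(1)
    show False by (simp add: stable_def)
  qed
  moreover have "F 1 y = 0"
  proof (rule ccontr)
    assume "F 1 y \<noteq> 0"
    with lower[OF _ _ wt_space_F[OF y', of 1], of "int a" "int c - 1"] U(1) y(1)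
    show False by (simp add: stable_def)
  qed
  ultimately have sing: "singular y" by (simp add: singular_def)
  obtain n where "(F 0 ^^ n) y = 0" using nilF[OF y'] ..
  from F0_nilpotent_imp_dominant[OF _ y' y(2) this] sing
  obtain i where i: "of_nat j - 2 * of_nat a + 2 * of_nat c = (of_nat i :: complex)"
    by (auto simp: singular_def)
  \<comment> \<open>The diagram automorphism turns \<open>E (-1)\<close> into the new
    \<open>F 0\<close> and the \<open>H 0\<close>-value \<open>i\<close> into \<open>m - i\<close>,
    so the string argument also bounds \<open>i\<close> by \<open>M\<close>.\<close>
  interpret flip: loop_module scale "\<lambda>n. F (n + 1)" "\<lambda>n x. scale (if n = 0 then m else 0) x - H n x"
    "\<lambda>n. E (n - 1)" "\<lambda>x. D x + scale (1 / 2) (H 0 x) - scale 0 x" m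
    by (rule loop_module_flip)
  have flip_wt: "y \<in> flip.wt_space (m - of_nat i) (q0 - of_nat c + of_nat i / 2)"
    using y' unfolding flip.wt_space_def
    by (simp add: wt_space_def i scale_left_diff_distrib scale_left_distrib)
  obtain n where n: "(E (-1) ^^ n) y = 0" using nilE[OF y'] ..
  have "\<exists>i'. m - of_nat i = of_nat i'"
    by (rule flip.F0_nilpotent_imp_dominant[OF _ flip_wt y(2), of n])
      (use sing n in \<open>simp_all add: singular_def\<close>)
  then obtain i' where "m - of_nat i = of_nat i'" ..
  then have "of_nat M = (of_nat (i + i') :: complex)" using m by (simp add: algebra_simps)
  then have M: "i \<le> M" unfolding of_nat_eq_iff by simp
  obtain N0 where "\<forall>N\<ge>N0. casimir N y = scale (2 * (m + 2) * q0 + (of_nat j)\<^sup>2 / 2 + of_nat j) y"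
    using casimir_generated[OF v(1,3)] U(2) y(1) by blast
  then have "scale (2 * (m + 2) * q0 + (of_nat j)\<^sup>2 / 2 + of_nat j) y =
      scale (2 * (m + 2) * (q0 - of_nat c) + (of_nat i)\<^sup>2 / 2 + of_nat i) y"
    using casimir_singular[OF sing y', of N0, unfolded i] by (metis order_refl)
  then have cas: "2 * (m + 2) * q0 + (of_nat j)\<^sup>2 / 2 + of_nat j =
      2 * (m + 2) * (q0 - of_nat c) + (of_nat i)\<^sup>2 / 2 + of_nat i"
    using y(2) scale_right_imp_eq by blast
  have "complex_of_int (4 * (int M + 2) * int c) = of_int ((int i - int j) * (int i + int j + 2))"
    using arg_cong[OF cas, of "(*) 2"] m(1) by (simp add: algebra_simps power2_eq_square)
  then have cas': "4 * (int M + 2) * int c = (int i - int j) * (int i + int j + 2)"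
    by (simp only: of_int_eq_iff)
  have "of_int (int i) = (of_int (int j - 2 * int a + 2 * int c) :: complex)" using i by simp
  then have i': "int i - int j = 2 * (int c - int a)" unfolding of_int_eq_iff by simp
  with cas' have eq: "2 * (int M + 2) * int c = (int c - int a) * (int i + int j + 2)"
    by (simp add: algebra_simps)
  \<comment> \<open>As \<open>i\<close> and \<open>j\<close> are at most \<open>M\<close>, the
    factor i + j + 2 is below 2 (M + 2), so \<open>eq\<close> is impossible for positive
    \<open>c\<close>.\<close>
  have "c = 0"
  proof (rule ccontr)
    assume c: "c \<noteq> 0"
    have "(int c - int a) * (int i + int j + 2) \<le> int c * (int i + int j + 2)"
      by (intro mult_right_mono) auto
    also have "\<dots> < int c * (2 * (int M + 2))"
      using c M m(2) by (intro mult_strict_left_mono) auto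
    finally show False using eq by (simp add: mult.commute)
  qed
  moreover from this eq have "a = 0" by (simp add: mult_eq_0_iff)
  ultimately have "y \<in> wt_space (of_nat j) q0" using y' by simp
  then obtain z where z: "y = scale z v" using generated_top[OF v(3)] U(2) y(1) by blast
  with y(2) have "z \<noteq> 0" by auto
  with z have "v = scale (inverse z) y" by simp
  then have "v \<in> U" using subspace_scale[OF sub y(1)] by simp
  then show ?thesis using generated_minimal[OF U(1)] U(2) by blast
qed

section \<open>Irreducible highest weight modules under the twists\<close>

definition irreducible_hw :: "nat \<Rightarrow> nat \<Rightarrow> 'v \<Rightarrow> bool" where
  "irreducible_hw M j v \<longleftrightarrow> m = of_nat M \<and> j \<le> M \<and> v \<noteq> 0 \<and> singular v \<and> v \<in> wt_space (of_nat j) 0 \<and>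
     (\<forall>U. stable U \<longrightarrow> U = {0} \<or> U = UNIV)"

lemma irreducible_hw_generated:
  assumes "irreducible_hw M j v"
  shows "generated v = UNIV"
  using assms stable_generated[of v] generated_base[of v] by (auto simp: irreducible_hw_def)

lemma F1_F0_power: "F 1 ((F 0 ^^ i) x) = (F 0 ^^ i) (F 1 x)"
  by (induction i) (simp_all add: F_F[of 1 0])

lemma F0_power_zero: "(F 0 ^^ i) 0 = 0"
  by (induction i) simp_all

text \<open>If nonzero, this vector would be singular and generate the whole module, but the weight
  of \<open>v\<close> is not among the weights below its own.\<close>

lemma irreducible_hw_F0_power:
  assumes "irreducible_hw M j v"
  shows "(F 0 ^^ Suc j) v = 0"
proof (rule ccontr)
  let ?y = "(F 0 ^^ Suc j) v"
  assume nz: "?y \<noteq> 0"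
  from assms have v: "singular v" "v \<in> wt_space (of_nat j) 0" "v \<noteq> 0" by (simp_all add: irreducible_hw_def)
  have "E 0 ?y = 0" using E0_F0_power[of v "of_nat j" 0 j] v by (simp add: singular_def del: funpow.simps)
  moreover have "F 1 ?y = 0" unfolding F1_F0_power using v(1) by (simp add: singular_def F0_power_zero)
  ultimately have y: "singular ?y" by (simp only: singular_def)
  note wt = wt_space_F0_power[OF v(2), of "Suc j"]
  have "stable (generated ?y)" by (rule stable_generated[OF y wt])
  then have "generated ?y = UNIV" using assms generated_base[of ?y] nz by (auto simp: irreducible_hw_def)
  then obtain a c :: nat where ac: "of_nat j = of_nat j - 2 * of_nat (Suc j) - 2 * of_nat a + 2 * (of_nat c :: complex)"
    "0 = 0 - (of_nat c :: complex)"
    using generated_wt[OF wt _ v(2,3)] by blast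
  then have "2 * (of_nat (Suc j + a) :: complex) = 0" by (simp add: algebra_simps)
  then show False unfolding mult_eq_0_iff of_nat_eq_0_iff by simp
qed

text \<open>The reflection exchanges the ends of the string through \<open>v\<close>. The bottom end
  is killed by \<open>E 1\<close>, the new \<open>F 1\<close>, because no weight has
  \<open>D\<close>-value 1.\<close>

lemma irreducible_hw_swap:
  assumes "irreducible_hw M j v"
  shows "loop_module.irreducible_hw scale F (\<lambda>n x. - H n x) E D m M j ((F 0 ^^ j) v)"
proof -
  interpret swap: loop_module scale F "\<lambda>n x. - H n x" E D m
    by (rule loop_module_swap)
  from assms have v: "singular v" "v \<in> wt_space (of_nat j) 0" "v \<noteq> 0" by (simp_all add: irreducible_hw_def)
  let ?y = "(F 0 ^^ j) v"
  have wt: "?y \<in> wt_space (- of_nat j) 0"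
    using wt_space_F0_power[OF v(2), of j] by simp
  have "E 1 ?y = 0"
  proof (rule ccontr)
    assume "E 1 ?y \<noteq> 0"
    with generated_wt[OF v(2) _ wt_space_E[OF wt, of 1]] irreducible_hw_generated[OF assms]
    obtain c :: nat where "1 = - (of_nat c :: complex)" by (metis UNIV_I add_0 diff_0 of_int_1)
    then have "complex_of_nat (Suc c) = 0" by (simp add: eq_neg_iff_add_eq_0)
    then show False unfolding of_nat_eq_0_iff by simp
  qed
  then have "swap.singular ?y"
    using irreducible_hw_F0_power[OF assms] by (simp add: swap.singular_def)
  moreover have "?y \<noteq> 0" using F0_power_nonzero[OF _ v(2,3) order_refl] v(1) by (simp add: singular_def)
  moreover have "?y \<in> swap.wt_space (of_nat j) 0" using wt by (simp add: wt_space_def swap.wt_space_def)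
  moreover have "stable U" if "swap.stable U" for U
    using that subspace_neg[of U] unfolding stable_def swap.stable_def by (metis minus_minus)
  ultimately show ?thesis using assms unfolding irreducible_hw_def swap.irreducible_hw_def by blast
qed

text \<open>The two raising generators are merely exchanged, so \<open>v\<close> stays singular. The
  shift by \<open>j / 2\<close> restores its \<open>D\<close>-value 0, so that the twists can be
  iterated.\<close>

lemma irreducible_hw_flip:
  assumes "irreducible_hw M j v"
  shows "loop_module.irreducible_hw scale (\<lambda>n. F (n + 1)) (\<lambda>n x. scale (if n = 0 then m else 0) x - H n x)
    (\<lambda>n. E (n - 1)) (\<lambda>x. D x + scale (1 / 2) (H 0 x) - scale (of_nat j / 2) x) m M (M - j) v"
proof -
  interpret flip: loop_module scale "\<lambda>n. F (n + 1)" "\<lambda>n x. scale (if n = 0 then m else 0) x - H n x"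
    "\<lambda>n. E (n - 1)" "\<lambda>x. D x + scale (1 / 2) (H 0 x) - scale (of_nat j / 2) x" m
    by (rule loop_module_flip)
  have "stable U" if U: "flip.stable U" for U
  proof -
    have sub: "subspace U" using U by (simp add: flip.stable_def)
    have EF: "E n x \<in> U" "F n x \<in> U" if "x \<in> U" for n x
      using U that unfolding flip.stable_def by (metis add_diff_cancel diff_add_cancel)+
    have H: "H n x \<in> U" if "x \<in> U" for n x
    proof -
      have "scale (if n = 0 then m else 0) x - (scale (if n = 0 then m else 0) x - H n x) \<in> U"
        by (rule subspace_diff[OF sub subspace_scale[OF sub that]])
          (use U that in \<open>unfold flip.stable_def, blast\<close>)
      then show ?thesis by simp
    qed
    have "D x \<in> U" if "x \<in> U" for x
    proof -
      have "(D x + scale (1 / 2) (H 0 x) - scale (of_nat j / 2) x) - scale (1 / 2) (H 0 x)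
          + scale (of_nat j / 2) x \<in> U"
        by (rule subspace_add[OF sub subspace_diff[OF sub _ subspace_scale[OF sub H[OF that]]]
              subspace_scale[OF sub that]]) (use U that in \<open>unfold flip.stable_def, blast\<close>)
      then show ?thesis by simp
    qed
    then show ?thesis using EF H sub by (simp add: stable_def)
  qed
  moreover have "flip.singular v" using assms by (simp add: flip.singular_def irreducible_hw_def singular_def)
  moreover have "v \<in> flip.wt_space (of_nat (M - j)) 0"
    using assms
    by (simp add: flip.wt_space_def irreducible_hw_def wt_space_def of_nat_diff scale_left_diff_distrib)
  ultimately show ?thesis using assms unfolding irreducible_hw_def flip.irreducible_hw_def by auto
qed

end

section \<open>The boundary of the set of weights\<close>

text \<open>The values of \<open>\<lambda>(h\<^sub>1)\<close> at which the slope of the boundary of the set of weights changes, for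
  the highest weight \<open>M\<Lambda>\<^sub>0 + j\<alpha>/2\<close>.\<close>

fun wall :: "nat \<Rightarrow> nat \<Rightarrow> nat \<Rightarrow> int" where
  "wall M j 0 = int j"
| "wall M j (Suc k) = wall M (M - j) k + int M"

lemma wall_eq:
  assumes "j \<le> M"
  shows "wall M j k = (if even k then int k * int M + int j else (int k + 1) * int M - int j)"
  using assms by (induction k arbitrary: j) (auto simp: algebra_simps of_nat_diff)

lemma between_walls:
  assumes "wall M j 0 \<le> p" "p \<le> wall M j (Suc n)"
  shows "\<exists>k \<le> n. wall M j k \<le> p \<and> p \<le> wall M j (Suc k)"
  using assms
proof (induction n)
  case (Suc n)
  then show ?case by (cases "p \<le> wall M j (Suc n)") (auto simp del: wall.simps intro: le_SucI)
qed auto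

lemma (in loop_module) wt_space_E_power:
  assumes "x \<in> wt_space p q"
  shows "(E n ^^ i) x \<in> wt_space (p + 2 * of_nat i) (q + of_int n * of_nat i)"
proof (induction i)
  case (Suc i)
  from wt_space_E[OF this, of n] show ?case by (simp add: algebra_simps)
qed (use assms in simp)

text \<open>In the coordinates \<open>P\<close> and \<open>2 N\<close>, where \<open>- N\<close> is the value on \<open>d\<close>, all weights lie above the
  line of slope \<open>k + 1\<close> through the vertices over \<open>wall M j k\<close> and \<open>wall M j (Suc k)\<close>. The case \<open>k = 0\<close> is the bound on weights
  of a highest weight module together with an \<open>sl\<^sub>2\<close>-string; the spectral flow, which is the
  composition of the two twists, increases the slope by one.\<close>

lemma weight_boundary:
  fixes scale :: "complex \<Rightarrow> 'v::ab_group_add \<Rightarrow> 'v"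
  assumes "loop_module scale E H F D m" "loop_module.irreducible_hw scale E H F D m M j v"
  shows "\<exists>b::int.
    (\<forall>p q x. x \<noteq> 0 \<longrightarrow> x \<in> loop_module.wt_space scale H D p q \<longrightarrow>
      (\<exists>P N. p = of_int P \<and> q = - of_int N \<and> even (P - int j) \<and> 2 * N \<ge> (int k + 1) * P + b)) \<and>
    (\<forall>P. wall M j k \<le> P \<longrightarrow> P \<le> wall M j (Suc k) \<longrightarrow> even (P - int j) \<longrightarrow>
      (\<exists>x. x \<noteq> 0 \<and> x \<in> loop_module.wt_space scale H D (of_int P) (- (of_int ((int k + 1) * P + b) / 2))))"
  using assms
proof (induction k arbitrary: E H F D j v)
  case 0
  interpret loop_module scale E H F D m by fact
  have hw: "irreducible_hw M j v" by fact
  then have v: "singular v" "v \<in> wt_space (of_nat j) 0" "v \<noteq> 0" and m: "m = of_nat M" and j: "j \<le> M"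
    by (simp_all add: irreducible_hw_def)
  interpret flip: loop_module scale "\<lambda>n. F (n + 1)" "\<lambda>n x. scale (if n = 0 then m else 0) x - H n x"
    "\<lambda>n. E (n - 1)" "\<lambda>x. D x + scale (1 / 2) (H 0 x) - scale (of_nat j / 2) x" m
    by (rule loop_module_flip)
  have flip_hw: "flip.irreducible_hw M (M - j) v" by (rule irreducible_hw_flip[OF hw])
  show ?case
  \<comment> \<open>After \<open>a\<close> and \<open>c\<close> lowerings P - j = 2 c - 2 a is at
    most 2 N = 2 c. Equality holds for a = 0, in particular on the \<alpha>_0-string through
    \<open>v\<close>, which runs from \<open>j\<close> to 2 M - j.\<close>
  proof (rule exI[of _ "- int j"], intro conjI allI impI)
    fix p q x assume x: "x \<noteq> 0" "x \<in> wt_space p q"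
    obtain a c :: nat where "p = of_nat j - 2 * of_nat a + 2 * of_nat c" "q = 0 - of_nat c"
      using generated_wt[OF v(2) _ x(2,1)] irreducible_hw_generated[OF hw] by blast
    then show "\<exists>P N. p = of_int P \<and> q = - of_int N \<and> even (P - int j) \<and> 2 * N \<ge> (int 0 + 1) * P + - int j"
      by (intro exI[of _ "int j - 2 * int a + 2 * int c"] exI[of _ "int c"]) simp
  next
    fix P assume P: "wall M j 0 \<le> P" "P \<le> wall M j (Suc 0)" "even (P - int j)"
    define i where "i = nat ((P - int j) div 2)"
    have i: "P = int j + 2 * int i" "i \<le> M - j" using P j by (auto simp: i_def)
    have "(E (0 - 1) ^^ i) v \<noteq> 0"
      using flip.F0_power_nonzero[of v "M - j" 0 i] flip_hw i(2)
      unfolding flip.irreducible_hw_def flip.singular_def by blast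
    moreover have "(E (0 - 1) ^^ i) v \<in> wt_space (of_int P) (- (of_int ((int 0 + 1) * P + - int j) / 2))"
      using wt_space_E_power[OF v(2), where n = "-1" and i = i] i(1) by simp
    ultimately show "\<exists>x. x \<noteq> 0 \<and> x \<in> wt_space (of_int P) (- (of_int ((int 0 + 1) * P + - int j) / 2))"
      by blast
  qed
next
  case (Suc k)
  interpret loop_module scale E H F D m by fact
  have hw: "irreducible_hw M j v" by fact
  then have m: "m = of_nat M" and j: "j \<le> M" by (simp_all add: irreducible_hw_def)
  let ?H = "\<lambda>n x. - (scale (if n = 0 then m else 0) x - H n x)"
  let ?D = "\<lambda>x. D x + scale (1 / 2) (H 0 x) - scale (of_nat j / 2) x"
  interpret flip: loop_module scale "\<lambda>n. F (n + 1)" "\<lambda>n x. scale (if n = 0 then m else 0) x - H n x"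
    "\<lambda>n. E (n - 1)" ?D m
    by (rule loop_module_flip)
  \<comment> \<open>This is the spectral flow; it takes the weight \<open>(p, q)\<close> to
    \<open>(p - m, q + p / 2 - j / 2)\<close>.\<close>
  interpret flow: loop_module scale "\<lambda>n. E (n - 1)" ?H "\<lambda>n. F (n + 1)" ?D m
    by (rule flip.loop_module_swap)
  have wt: "x \<in> flow.wt_space (p - m) (q + p / 2 - of_nat j / 2) \<longleftrightarrow> x \<in> wt_space p q" for x p q
  proof -
    have "- (scale m x - H 0 x) = scale (p - m) x \<longleftrightarrow> H 0 x = scale p x"
      by (simp add: scale_left_diff_distrib)
    moreover have "H 0 x = scale p x \<Longrightarrow>
      ?D x = scale (q + p / 2 - of_nat j / 2) x \<longleftrightarrow> D x = scale q x"
      by (simp add: scale_left_diff_distrib scale_left_distrib)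
    ultimately show ?thesis unfolding flow.wt_space_def wt_space_def by auto
  qed
  obtain b :: int where b1: "\<And>p q x. x \<noteq> 0 \<Longrightarrow> x \<in> flow.wt_space p q \<Longrightarrow>
      \<exists>P N. p = of_int P \<and> q = - of_int N \<and> even (P - int (M - j)) \<and> 2 * N \<ge> (int k + 1) * P + b"
    and b2: "\<And>P. wall M (M - j) k \<le> P \<Longrightarrow> P \<le> wall M (M - j) (Suc k) \<Longrightarrow> even (P - int (M - j)) \<Longrightarrow>
      \<exists>x. x \<noteq> 0 \<and> x \<in> flow.wt_space (of_int P) (- (of_int ((int k + 1) * P + b) / 2))"
    using Suc.IH[OF flip.loop_module_swap flip.irreducible_hw_swap[OF irreducible_hw_flip[OF hw]]]
    by blast
  show ?case
  \<comment> \<open>Put p = P + M in the bound for the twisted module. Undoing the flow adds p - j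
    to 2 N, which raises the slope by one and leaves this constant.\<close>
  proof (rule exI[of _ "b - (int k + 1) * int M - int j"], intro conjI allI impI)
    fix p q x assume x: "x \<noteq> 0" "x \<in> wt_space p q"
    then obtain P N where P: "p - m = of_int P" and N: "q + p / 2 - of_nat j / 2 = - of_int N"
      and parity: "even (P - int (M - j))" and le: "2 * N \<ge> (int k + 1) * P + b"
      using b1[of x] wt by blast
    have par: "even (P + int M - int j)" using parity j by (auto simp: of_nat_diff)
    then obtain r where r: "P + int M - int j = 2 * r" by blast
    have p: "p = of_int (P + int M)" using P m by (simp add: algebra_simps)
    have "(of_int (P + int M - int j) :: complex) = of_int (2 * r)" using r by (rule arg_cong)
    with p have "(p - of_nat j) / 2 = of_int r" by simp
    moreover have "q = - of_int N - (p - of_nat j) / 2"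
      unfolding N[symmetric] by (simp add: diff_divide_distrib)
    ultimately have "q = - of_int (N + r)" by simp
    moreover have "2 * (N + r) \<ge> (int (Suc k) + 1) * (P + int M) + (b - (int k + 1) * int M - int j)"
    proof -
      have "(int (Suc k) + 1) * (P + int M) + (b - (int k + 1) * int M - int j)
          = (int k + 1) * P + b + (P + int M - int j)"
        by (simp add: algebra_simps)
      with le r show ?thesis by simp
    qed
    ultimately show "\<exists>P N. p = of_int P \<and> q = - of_int N \<and> even (P - int j) \<and>
        2 * N \<ge> (int (Suc k) + 1) * P + (b - (int k + 1) * int M - int j)"
      using p par by blast
  next
    fix P assume P: "wall M j (Suc k) \<le> P" "P \<le> wall M j (Suc (Suc k))" "even (P - int j)"
    have "even (P - int M - int (M - j))" using P(3) j by (simp add: of_nat_diff)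
    with b2[of "P - int M"] P obtain x where x: "x \<noteq> 0"
      "x \<in> flow.wt_space (of_int (P - int M)) (- (of_int ((int k + 1) * (P - int M) + b) / 2))"
      by auto
    define q :: complex where "q = - (of_int ((int (Suc k) + 1) * P + (b - (int k + 1) * int M - int j)) / 2)"
    have "of_int (P - int M) = of_int P - m" using m by simp
    moreover have "- (of_int ((int k + 1) * (P - int M) + b) / 2) = q + of_int P / 2 - of_nat j / 2"
      by (simp add: q_def field_simps)
    ultimately have "x \<in> wt_space (of_int P) q" using x(2) wt[of x "of_int P" q] by simp
    with x(1) show "\<exists>x. x \<noteq> 0 \<and> x \<in> wt_space (of_int P)
        (- (of_int ((int (Suc k) + 1) * P + (b - (int k + 1) * int M - int j)) / 2))"
      unfolding q_def by blast
  qed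
qed

section \<open>Local nilpotency and vectors singular for the winding subalgebra\<close>

context loop_module begin

lemma irreducible_hw_wt:
  assumes "irreducible_hw M j v" "x \<noteq> 0" "x \<in> wt_space p q"
  obtains P N where "p = of_int P" "q = - of_int N" "even (P - int j)"
  using weight_boundary[OF loop_module_axioms assms(1), of 0] assms(2,3) by blast

text \<open>Along the string 2 N grows by 2 u per step while the boundary line of slope u + 1 rises
  by 2 (u + 1), so the string leaves the set of weights.\<close>

lemma E_power_nilpotent:
  assumes hw: "irreducible_hw M j v" and x: "x \<in> wt_space p q"
  shows "\<exists>i. (E (- int u) ^^ i) x = 0"
proof (rule ccontr)
  assume "\<not> ?thesis"
  then have nz: "(E (- int u) ^^ i) x \<noteq> 0" for i by blast
  obtain b where b: "\<And>p q x. x \<noteq> 0 \<Longrightarrow> x \<in> wt_space p q \<Longrightarrow>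
      \<exists>P N. p = of_int P \<and> q = - of_int N \<and> even (P - int j) \<and> 2 * N \<ge> (int u + 1) * P + b"
    using weight_boundary[OF loop_module_axioms hw, of u] by blast
  have "x \<noteq> 0" using nz[of 0] by simp
  from b[OF this x] obtain P N where P: "p = of_int P" "q = - of_int N" by blast
  have bound: "2 * (N + int u * int i) \<ge> (int u + 1) * (P + 2 * int i) + b" for i
  proof -
    obtain P' N' where P': "p + 2 * of_nat i = of_int P'" "q + of_int (- int u) * of_nat i = - of_int N'"
      "2 * N' \<ge> (int u + 1) * P' + b"
      using b[OF nz wt_space_E_power[OF x], of i] by blast
    have "of_int P' = (of_int (P + 2 * int i) :: complex)" "of_int N' = (of_int (N + int u * int i) :: complex)"
      using P P'(1,2) by (simp_all add: algebra_simps)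
    then show ?thesis using P'(3) unfolding of_int_eq_iff by simp
  qed
  define z where "z = 2 * N - (int u + 1) * P - b"
  define i where "i = nat (\<bar>z\<bar> + 1)"
  have "2 * int i > z" by (simp add: i_def)
  with bound[of i] show False by (simp add: z_def algebra_simps)
qed

text \<open>The reflection turns \<open>F 0\<close> into the new \<open>E 0\<close>, to which the
  preceding lemma applies with \<open>u\<close> equal to 0.\<close>

lemma F0_power_nilpotent:
  assumes hw: "irreducible_hw M j v" and x: "x \<in> wt_space p q"
  shows "\<exists>i. (F 0 ^^ i) x = 0"
proof -
  interpret swap: loop_module scale F "\<lambda>n x. - H n x" E D m
    by (rule loop_module_swap)
  have "x \<in> swap.wt_space (- p) q" using x by (simp add: wt_space_def swap.wt_space_def)
  from swap.E_power_nilpotent[OF irreducible_hw_swap[OF hw] this, of 0] show ?thesis by simp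
qed

definition winding_singular :: "nat \<Rightarrow> 'v \<Rightarrow> bool" where
  "winding_singular u x \<longleftrightarrow> (\<forall>n\<ge>0. E (int u * n) x = 0) \<and>
     (\<forall>n\<ge>1. H (int u * n) x = 0 \<and> F (int u * n) x = 0)"

definition winding_stable :: "nat \<Rightarrow> 'v set \<Rightarrow> bool" where
  "winding_stable u U \<longleftrightarrow> subspace U \<and> (\<forall>x \<in> U. D x \<in> U \<and>
     (\<forall>n. E (int u * n) x \<in> U \<and> H (int u * n) x \<in> U \<and> F (int u * n) x \<in> U))"

text \<open>A vector of maximal weight in the given range is singular for the winding subalgebra because
  there the slope of the boundary is smaller than \<open>u\<close>; the module it generates is irreducible by the
  Casimir argument.\<close>

lemma winding_branching:
  assumes hw: "irreducible_hw M j v" and u: "u > 1"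
    and p: "wall M j 0 \<le> p" "p \<le> wall M j (u - 1)" "p \<le> int u * int M" "even (p - int j)"
  obtains N x W where "x \<noteq> 0" "x \<in> wt_space (of_int p) (- of_int N)"
    "\<And>y q. y \<noteq> 0 \<Longrightarrow> y \<in> wt_space (of_int p) q \<Longrightarrow> \<exists>N' \<ge> N. q = - of_int N'"
    "winding_singular u x" "winding_stable u W" "x \<in> W"
    "\<And>U. winding_stable u U \<Longrightarrow> x \<in> U \<Longrightarrow> W \<subseteq> U"
    "\<And>U. winding_stable u U \<Longrightarrow> U \<subseteq> W \<Longrightarrow> U = {0} \<or> U = W"
proof -
  have m: "m = of_nat M" using hw by (simp add: irreducible_hw_def)
  \<comment> \<open>Stopping at the wall of index u - 1 gives k \<le> u - 2, so the boundary slope k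
    + 1 at \<open>p\<close> is less than \<open>u\<close>.\<close>
  have "p \<le> wall M j (Suc (u - 2))" using p(2) u by (simp add: Suc_diff_Suc numeral_2_eq_2)
  from between_walls[OF p(1) this] obtain k where k: "k \<le> u - 2" "wall M j k \<le> p" "p \<le> wall M j (Suc k)"
    by blast
  obtain b where b1: "\<And>p q x. x \<noteq> 0 \<Longrightarrow> x \<in> wt_space p q \<Longrightarrow>
      \<exists>P N. p = of_int P \<and> q = - of_int N \<and> even (P - int j) \<and> 2 * N \<ge> (int k + 1) * P + b"
    and b2: "\<exists>x. x \<noteq> 0 \<and> x \<in> wt_space (of_int p) (- (of_int ((int k + 1) * p + b) / 2))"
    using weight_boundary[OF loop_module_axioms hw, of k] k(2,3) p(4) by blast
  from b2 obtain x where x: "x \<noteq> 0" "x \<in> wt_space (of_int p) (- (of_int ((int k + 1) * p + b) / 2))"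
    by blast
  from b1[OF this] obtain N where N: "- (of_int ((int k + 1) * p + b) / 2) = (- of_int N :: complex)" by blast
  then have "(of_int ((int k + 1) * p + b) :: complex) = of_int (2 * N)" by simp
  then have N': "(int k + 1) * p + b = 2 * N" unfolding of_int_eq_iff .
  have x': "x \<in> wt_space (of_int p) (- of_int N)" using x(2) N by simp
  have bound: "2 * N' \<ge> (int k + 1) * P + b"
    if y: "y \<noteq> 0" "y \<in> wt_space p' q'" and eq: "p' = of_int P" "q' = - of_int N'" for y P N' p' q'
  proof -
    obtain P2 N2 where "p' = of_int P2" "q' = - of_int N2" "2 * N2 \<ge> (int k + 1) * P2 + b"
      using b1[OF y] by blast
    with eq show ?thesis by simp
  qed
  interpret w: loop_module scale "\<lambda>n. E (int u * n)" "\<lambda>n. H (int u * n)" "\<lambda>n. F (int u * n)"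
    "\<lambda>x. scale (1 / of_nat u) (D x)" "of_nat u * m"
    by (rule loop_module_winding) (use u in simp)
  have wt_w: "y \<in> w.wt_space p' q' \<longleftrightarrow> y \<in> wt_space p' (of_nat u * q')" for y p' q'
  proof -
    have "scale (1 / of_nat u) (D y) = scale q' y \<longleftrightarrow> D y = scale (of_nat u * q') y"
    proof
      assume "scale (1 / of_nat u) (D y) = scale q' y"
      then have "scale (of_nat u) (scale (1 / of_nat u) (D y)) = scale (of_nat u) (scale q' y)" by simp
      then show "D y = scale (of_nat u * q') y" using u by simp
    qed (use u in simp)
    then show ?thesis by (simp add: wt_space_def w.wt_space_def)
  qed
  \<comment> \<open>The image would have the same N, while the bound rises by 2 (k + 1) above the
    value 2 N attained at \<open>p\<close>.\<close>
  have "E (int u * 0) x = 0"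
  proof (rule ccontr)
    assume "E (int u * 0) x \<noteq> 0"
    from bound[OF this wt_space_E[OF x'], of "p + 2" N] show False using N' by (simp add: algebra_simps)
  qed
  \<comment> \<open>Here 2 N drops by 2 u but the bound only by 2 (k + 1).\<close>
  moreover have "F (int u * 1) x = 0"
  proof (rule ccontr)
    assume "F (int u * 1) x \<noteq> 0"
    from bound[OF this wt_space_F[OF x'], of "p - 2" "N - int u"] show False
      using N' k(1) u by (simp add: algebra_simps)
  qed
  ultimately have sing: "w.singular x" by (simp add: w.singular_def)
  have p0: "0 \<le> p" using p(1) by simp
  have xw: "x \<in> w.wt_space (of_nat (nat p)) (- of_int N / of_nat u)"
    using x' u p0 by (simp add: wt_w)
  have stable: "w.stable U \<longleftrightarrow> winding_stable u U" for U
  proof -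
    have "scale (1 / of_nat u) (D y) \<in> U \<longleftrightarrow> D y \<in> U" if "subspace U" for y
      using subspace_scale[OF that, of "scale (1 / of_nat u) (D y)" "of_nat u"]
        subspace_scale[OF that, of "D y" "1 / of_nat u"] u by auto
    then show ?thesis unfolding w.stable_def winding_stable_def by auto
  qed
  show thesis
  proof (rule that[of x N "w.generated x"])
    fix y q assume y: "y \<noteq> 0" "y \<in> wt_space (of_int p) q"
    obtain P2 N2 where 2: "of_int p = (of_int P2 :: complex)" "q = - of_int N2" "2 * N2 \<ge> (int k + 1) * P2 + b"
      using b1[OF y] by blast
    then show "\<exists>N' \<ge> N. q = - of_int N'" using N' by (intro exI[of _ N2]) simp
  next
    have E: "E (int u * n) x = 0" if "n \<ge> 0" for n using w.singular_imp(1)[OF sing, of "nat n"] that by simp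
    have "H (int u * n) x = 0" "F (int u * n) x = 0" if "n \<ge> 1" for n
      using w.singular_imp(2,3)[OF sing, of "nat (n - 1)"] that by simp_all
    with E show "winding_singular u x" by (simp add: winding_singular_def)
  next
    show "winding_stable u (w.generated x)" using w.stable_generated[OF sing xw] stable by simp
  next
    fix U assume "winding_stable u U" "x \<in> U"
    then show "w.generated x \<subseteq> U" using w.generated_minimal stable by simp
  next
    fix U assume U: "winding_stable u U" "U \<subseteq> w.generated x"
    have nilF: "\<exists>n. (F (int u * 0) ^^ n) y = 0" if "y \<in> w.wt_space p' q'" for y p' q'
      using F0_power_nilpotent[OF hw] that wt_w by simp
    have nilE: "\<exists>n. (E (int u * - 1) ^^ n) y = 0" if "y \<in> w.wt_space p' q'" for y p' q'
      using E_power_nilpotent[OF hw, of y] that wt_w by simp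
    \<comment> \<open>The reindexed module has level u M, so \<open>p(3)\<close> is dominance for
      the winding subalgebra.\<close>
    have level: "of_nat u * m = of_nat (u * M)" "nat p \<le> u * M"
      using m p(3) p0 by (simp_all add: nat_le_iff)
    have "w.stable U" using U(1) stable by simp
    then show "U = {0} \<or> U = w.generated x"
      using w.irreducible_generated[OF sing x(1) xw level _ _ _ U(2)] nilF nilE by blast
  qed (use x(1) x' w.generated_base in auto)
qed

end

section \<open>Affine modules in terms of modes\<close>

lemma poly_mapping_eq_sum_single: "p = (\<Sum>n \<in> Poly_Mapping.keys p. Poly_Mapping.single n (Poly_Mapping.lookup p n))"
  by (rule poly_mapping_eqI) (simp add: lookup_sum lookup_single when_def sum.delta' in_keys_iff)

lemma euler_single: "euler (Poly_Mapping.single n c) = Poly_Mapping.single n (of_int n * c)"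
  by (rule poly_mapping_eqI) (auto simp: euler_def lookup_mapp lookup_single when_def in_keys_iff)

lemma euler_zero: "euler 0 = 0"
  using euler_single[of 0 0] by simp

lemma two_times_single: "(2::laurent) * Poly_Mapping.single n c = Poly_Mapping.single n (2 * c)"
  by (simp only: mult_2 single_add)

lemma lie_bracket_modes:
  "lie_bracket (Poly_Mapping.single r 1, 0, 0, 0, 0) (Poly_Mapping.single s 1, 0, 0, 0, 0) = (0, 0, 0, 0, 0)"
  "lie_bracket (0, 0, Poly_Mapping.single r 1, 0, 0) (0, 0, Poly_Mapping.single s 1, 0, 0) = (0, 0, 0, 0, 0)"
  "lie_bracket (Poly_Mapping.single r 1, 0, 0, 0, 0) (0, 0, Poly_Mapping.single s 1, 0, 0) =
    (0, Poly_Mapping.single (r + s) 1, 0, if r + s = 0 then of_int r else 0, 0)"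
  "lie_bracket (0, Poly_Mapping.single r 1, 0, 0, 0) (Poly_Mapping.single s 1, 0, 0, 0, 0) =
    (Poly_Mapping.single (r + s) 2, 0, 0, 0, 0)"
  "lie_bracket (0, Poly_Mapping.single r 1, 0, 0, 0) (0, 0, Poly_Mapping.single s 1, 0, 0) =
    (0, 0, Poly_Mapping.single (r + s) (- 2), 0, 0)"
  "lie_bracket (0, Poly_Mapping.single r 1, 0, 0, 0) (0, Poly_Mapping.single s 1, 0, 0, 0) =
    (0, 0, 0, if r + s = 0 then 2 * of_int r else 0, 0)"
  "lie_bracket d_elt (a, b, c, k, z) = (euler a, euler b, euler c, 0, 0)"
  by (simp_all add: mult_single euler_single euler_zero two_times_single lookup_single when_def d_elt_def
      single_uminus)

section \<open>From the Lie algebra action to modes\<close>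

context affine_module begin

definition mode_e :: "int \<Rightarrow> 'v \<Rightarrow> 'v" where "mode_e n = act (Poly_Mapping.single n 1, 0, 0, 0, 0)"
definition mode_h :: "int \<Rightarrow> 'v \<Rightarrow> 'v" where "mode_h n = act (0, Poly_Mapping.single n 1, 0, 0, 0)"
definition mode_f :: "int \<Rightarrow> 'v \<Rightarrow> 'v" where "mode_f n = act (0, 0, Poly_Mapping.single n 1, 0, 0)"

lemma module_hom_act: "module_hom scale scale (act x)"
  by unfold_locales (simp_all add: act_add_right act_scale_right)

lemma act_zero_left [simp]: "act 0 v = 0"
  using act_add_left[of 0 0 v] by simp

lemma act_diff_left: "act (x - y) v = act x v - act y v"
  using act_add_left[of "x - y" y v] by (simp add: eq_diff_eq)

lemma act_single:
  "act (Poly_Mapping.single n z, 0, 0, 0, 0) v = scale z (mode_e n v)"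
  "act (0, Poly_Mapping.single n z, 0, 0, 0) v = scale z (mode_h n v)"
  "act (0, 0, Poly_Mapping.single n z, 0, 0) v = scale z (mode_f n v)"
  "act (0, 0, 0, z, 0) v = scale z (act K_elt v)"
  "act (0, 0, 0, 0, z) v = scale z (act d_elt v)"
  using act_scale_left[of z "(Poly_Mapping.single n 1, 0, 0, 0, 0)" v]
    act_scale_left[of z "(0, Poly_Mapping.single n 1, 0, 0, 0)" v]
    act_scale_left[of z "(0, 0, Poly_Mapping.single n 1, 0, 0)" v]
    act_scale_left[of z K_elt v] act_scale_left[of z d_elt v]
  by (simp_all add: mode_e_def mode_h_def mode_f_def K_elt_def d_elt_def mult_single)

lemma act_split:
  "act (a, b, c, k, s) v = act (a, 0, 0, 0, 0) v + act (0, b, 0, 0, 0) v + act (0, 0, c, 0, 0) v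
     + scale k (act K_elt v) + scale s (act d_elt v)"
  by (simp add: act_single(4,5)[symmetric] act_add_left[symmetric])

lemma act_loop_sum:
  "act (p, 0, 0, 0, 0) v = (\<Sum>n \<in> Poly_Mapping.keys p. scale (Poly_Mapping.lookup p n) (mode_e n v))"
  "act (0, p, 0, 0, 0) v = (\<Sum>n \<in> Poly_Mapping.keys p. scale (Poly_Mapping.lookup p n) (mode_h n v))"
  "act (0, 0, p, 0, 0) v = (\<Sum>n \<in> Poly_Mapping.keys p. scale (Poly_Mapping.lookup p n) (mode_f n v))"
proof -
  have act_sum: "act (T (sum g I)) v = (\<Sum>n\<in>I. act (T (g n)) v)"
    if "\<And>p q. T (p + q) = T p + T q" "T 0 = 0"
    for T :: "laurent \<Rightarrow> affine_sl2" and g and I :: "int set"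
    by (induction I rule: infinite_finite_induct) (simp_all add: that act_add_left)
  show "act (p, 0, 0, 0, 0) v = (\<Sum>n \<in> Poly_Mapping.keys p. scale (Poly_Mapping.lookup p n) (mode_e n v))"
    by (subst poly_mapping_eq_sum_single[of p], subst act_sum[of "\<lambda>p. (p, 0, 0, 0, 0)"])
      (simp_all add: act_single zero_prod_def)
  show "act (0, p, 0, 0, 0) v = (\<Sum>n \<in> Poly_Mapping.keys p. scale (Poly_Mapping.lookup p n) (mode_h n v))"
    by (subst poly_mapping_eq_sum_single[of p], subst act_sum[of "\<lambda>p. (0, p, 0, 0, 0)"])
      (simp_all add: act_single zero_prod_def)
  show "act (0, 0, p, 0, 0) v = (\<Sum>n \<in> Poly_Mapping.keys p. scale (Poly_Mapping.lookup p n) (mode_f n v))"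
    by (subst poly_mapping_eq_sum_single[of p], subst act_sum[of "\<lambda>p. (0, 0, p, 0, 0)"])
      (simp_all add: act_single zero_prod_def)
qed

text \<open>Each loop component acts as a finite combination of modes. The zero subspace is allowed
  as \<open>W\<close>, which later shows that a vector is annihilated.\<close>

lemma act_in_subspace:
  assumes W: "subspace W"
    and "\<And>n. n \<in> Poly_Mapping.keys a \<Longrightarrow> mode_e n v \<in> W"
    and "\<And>n. n \<in> Poly_Mapping.keys b \<Longrightarrow> mode_h n v \<in> W"
    and "\<And>n. n \<in> Poly_Mapping.keys c \<Longrightarrow> mode_f n v \<in> W"
    and "scale k (act K_elt v) \<in> W" "scale s (act d_elt v) \<in> W"
  shows "act (a, b, c, k, s) v \<in> W"
  unfolding act_split[of a] act_loop_sum
  by (intro subspace_add[OF W] subspace_sum[OF W] subspace_scale[OF W] assms)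

lemma act_commute: "act x (act y v) = act y (act x v) + act (lie_bracket x y) v"
  by (simp add: act_bracket)

lemma act_K_commute: "act K_elt (act x v) = act x (act K_elt v)"
proof -
  obtain a b c k s where x: "x = (a, b, c, k, s)" by (cases x)
  have "lie_bracket K_elt x = 0"
    by (simp add: x K_elt_def euler_zero zero_prod_def)
  then show ?thesis using act_commute[of K_elt x v] by simp
qed

lemma loop_module_modes:
  assumes K: "\<And>v. act K_elt v = scale m v"
  shows "loop_module scale mode_e mode_h mode_f (act d_elt) m"
proof (intro loop_module.intro loop_module_axioms.intro vector_space_axioms)
  have zero: "act (0, 0, 0, 0, 0) x = 0" for x
    using act_zero_left by (simp add: zero_prod_def)
  show "mode_e r (mode_e s x) = mode_e s (mode_e r x)"
    and "mode_f r (mode_f s x) = mode_f s (mode_f r x)" for r s x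
    unfolding mode_e_def mode_f_def
    by (subst act_commute, simp only: lie_bracket_modes zero add_0_right)+
  show "mode_e r (mode_f s x) = mode_f s (mode_e r x) + mode_h (r + s) x
      + scale (if r + s = 0 then of_int r * m else 0) x" for r s x
    unfolding mode_e_def mode_f_def
    by (subst act_commute, simp only: lie_bracket_modes, subst act_split)
      (simp add: act_single(2) zero K add.assoc)
  show "mode_h r (mode_e s x) = mode_e s (mode_h r x) + scale 2 (mode_e (r + s) x)" for r s x
    using act_commute[of "(0, Poly_Mapping.single r 1, 0, 0, 0)" "(Poly_Mapping.single s 1, 0, 0, 0, 0)" x]
    unfolding lie_bracket_modes act_single by simp
  show "mode_h r (mode_f s x) = mode_f s (mode_h r x) - scale 2 (mode_f (r + s) x)" for r s x
    using act_commute[of "(0, Poly_Mapping.single r 1, 0, 0, 0)" "(0, 0, Poly_Mapping.single s 1, 0, 0)" x]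
    unfolding lie_bracket_modes act_single by simp
  show "mode_h r (mode_h s x) = mode_h s (mode_h r x)
      + scale (if r + s = 0 then 2 * of_int r * m else 0) x" for r s x
    unfolding mode_h_def
    by (subst act_commute, unfold lie_bracket_modes act_single K) simp
  show "act d_elt (mode_e r x) = mode_e r (act d_elt x) + scale (of_int r) (mode_e r x)"
    and "act d_elt (mode_h r x) = mode_h r (act d_elt x) + scale (of_int r) (mode_h r x)"
    and "act d_elt (mode_f r x) = mode_f r (act d_elt x) + scale (of_int r) (mode_f r x)" for r x
    using act_commute[of d_elt "(Poly_Mapping.single r 1, 0, 0, 0, 0)" x]
      act_commute[of d_elt "(0, Poly_Mapping.single r 1, 0, 0, 0)" x]
      act_commute[of d_elt "(0, 0, Poly_Mapping.single r 1, 0, 0)" x]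
    unfolding lie_bracket_modes euler_single euler_zero act_single by simp_all
qed (simp_all add: mode_e_def mode_h_def mode_f_def module_hom_act)

end

section \<open>Coordinates of weights and maximal shifts along \<delta>\<close>

lemma weight_components [simp]:
  "level_weight m j $ 1 = of_real m - of_int j" "level_weight m j $ 2 = of_int j" "level_weight m j $ 3 = 0"
  "delta $ 1 = 0" "delta $ 2 = 0" "delta $ 3 = 1"
  by (simp_all add: level_weight_def Lambda0_def alpha0_def alpha1_def delta_def)

lemma level_weight_eq_iff:
  "level_weight m j + b *s delta = level_weight m' j' + b' *s delta \<longleftrightarrow> m = m' \<and> j = j' \<and> b = b'"
proof
  assume *: "level_weight m j + b *s delta = level_weight m' j' + b' *s delta"
  from arg_cong[OF *, of "\<lambda>v. v $ 1"] arg_cong[OF *, of "\<lambda>v. v $ 2"] arg_cong[OF *, of "\<lambda>v. v $ 3"]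
  show "m = m' \<and> j = j' \<and> b = b'" by (simp del: of_real_of_int_eq)
qed simp

text \<open>A value -N' with N' > N is not maximal, since the positive integer shift N' - N leads to
  the attained value -N.\<close>

lemma is_b_iff:
  assumes "lam + (- of_int N) *s delta \<in> S"
    and "\<And>b. lam + b *s delta \<in> S \<Longrightarrow> \<exists>N' \<ge> N. b = - of_int N'"
  shows "is_b S lam b \<longleftrightarrow> b = - of_int N"
proof
  assume b: "is_b S lam b"
  then obtain N' where N': "N' \<ge> N" "b = - of_int N'" using assms(2) by (auto simp: is_b_def)
  show "b = - of_int N"
  proof (rule ccontr)
    assume "b \<noteq> - of_int N"
    with N' have "N' - N > 0" by auto
    with b have "lam + (b + of_int (N' - N)) *s delta \<notin> S" unfolding is_b_def by blast
    with assms(1) N'(2) show False by simp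
  qed
next
  assume b: "b = - of_int N"
  have "lam + (b + of_int n) *s delta \<notin> S" if "n > 0" for n
  proof
    assume "lam + (b + of_int n) *s delta \<in> S"
    then obtain N' where "N' \<ge> N" "b + of_int n = - of_int N'" using assms(2) by blast
    with b have "(of_int (n - N) :: complex) = of_int (- N')" by simp
    with \<open>N' \<ge> N\<close> \<open>n > 0\<close> show False unfolding of_int_eq_iff by simp
  qed
  with assms(1) b show "is_b S lam b" by (simp add: is_b_def)
qed

context affine_module begin

lemma subspace_weight_space: "subspace (weight_space lam)"
  by (rule subspaceI)
    (simp_all add: weight_space_def act_add_right act_scale_right scale_right_distrib scale_left_commute
      module_hom.zero[OF module_hom_act])

lemma in_weights_iff: "lam \<in> weights \<longleftrightarrow> (\<exists>x \<in> weight_space lam. x \<noteq> 0)"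
  using subspace_0[OF subspace_weight_space] by (auto simp: weights_def)

lemma act_h0: "act h0_elt v = act K_elt v - act h1_elt v"
  by (simp add: h0_elt_def act_diff_left)

lemma mode_h_zero: "mode_h 0 = act h1_elt"
  by (simp add: mode_h_def h1_elt_def)

lemma branching_weights_subset: "branching_weights u \<subseteq> weights"
  by (auto simp: branching_weights_def irreducible_highest_weight_def highest_weight_submodule_def in_weights_iff)

text \<open>\<open>K\<close> is central, so its eigenspace is a submodule; it contains the
  generating highest weight vector because K = h_0 + h_1.\<close>

lemma K_scalar:
  assumes "is_L Lam"
  shows "act K_elt v = scale (Lam $ 1 + Lam $ 2) v"
proof -
  let ?Z = "{v. act K_elt v = scale (Lam $ 1 + Lam $ 2) v}"
  obtain w where w: "w \<in> weight_space Lam" and gen: "\<And>U. submodule 1 U \<Longrightarrow> w \<in> U \<Longrightarrow> UNIV \<subseteq> U"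
    using assms unfolding is_L_def irreducible_highest_weight_def highest_weight_submodule_def by blast
  have "subspace ?Z"
    by (rule subspaceI) (simp_all add: act_add_right act_scale_right scale_right_distrib scale_left_commute
      module_hom.zero[OF module_hom_act])
  then have "submodule 1 ?Z"
    by (simp add: submodule_def act_K_commute act_scale_right)
  moreover have "act h0_elt w + act h1_elt w = act K_elt w" by (simp add: act_h0)
  then have "w \<in> ?Z" using w by (simp add: weight_space_def scale_left_distrib)
  ultimately show ?thesis using gen by blast
qed

lemma single_in_winding:
  "(Poly_Mapping.single (int u * n) 1, 0, 0, 0, 0) \<in> winding u"
  "(0, Poly_Mapping.single (int u * n) 1, 0, 0, 0) \<in> winding u"
  "(0, 0, Poly_Mapping.single (int u * n) 1, 0, 0) \<in> winding u"
  "d_elt \<in> winding u"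
  by (simp_all add: winding_def d_elt_def)

text \<open>Stability under \<open>K\<close> is automatic when it acts by a scalar; what remains is
  \<open>d\<close> and the modes whose index is divisible by \<open>u\<close>.\<close>

lemma submodule_iff:
  assumes K: "\<And>v. act K_elt v = scale m v"
  shows "submodule u W \<longleftrightarrow> loop_module.winding_stable scale mode_e mode_h mode_f (act d_elt) u W"
proof -
  interpret loop_module scale mode_e mode_h mode_f "act d_elt" m
    by (rule loop_module_modes[OF K])
  show ?thesis
  proof
    assume "submodule u W"
    then show "winding_stable u W"
      using single_in_winding[of u] unfolding submodule_def winding_stable_def mode_e_def mode_h_def mode_f_def
      by blast
  next
    assume W: "winding_stable u W"
    then have sub: "subspace W" by (simp add: winding_stable_def)
    have "act x v \<in> W" if x: "x \<in> winding u" and v: "v \<in> W" for x v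
    proof -
      obtain a b c k s where abc: "x = (a, b, c, k, s)" by (cases x)
      have modes: "mode_e n v \<in> W \<and> mode_h n v \<in> W \<and> mode_f n v \<in> W" if "int u dvd n" for n
        using W v that by (auto simp: winding_stable_def dvd_def)
      have "scale s (act d_elt v) \<in> W" "scale k (act K_elt v) \<in> W"
        using W v by (simp_all add: winding_stable_def K subspace_scale)
      then show ?thesis unfolding abc using x modes
        by (intro act_in_subspace[OF sub]) (auto simp: abc winding_def)
    qed
    with sub show "submodule u W" by (simp add: submodule_def)
  qed
qed

end

theorem theorem1p3:
  fixes scale :: "complex \<Rightarrow> 'v::ab_group_add \<Rightarrow> 'v"
    and act :: "affine_sl2 \<Rightarrow> 'v \<Rightarrow> 'v"
    and u :: nat and m j j' :: int and m' :: real
    and Lam lam :: weight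
  assumes "u > 1"
    and "Lam = level_weight (of_int m) j" and "Lam \<in> P_plus"
    and "lam = level_weight m' j'" and "lam \<in> P_plus_dot u"
    and "affine_module scale act" and "affine_module.is_L scale act Lam"
  shows "((\<exists>b. (Lam, lam + b *s delta) \<in> affine_module.Gamma scale act u) \<longrightarrow>
            even (j' - j) \<and> m' = of_int m) \<and>
         (even (j' - j) \<and> m' = of_int m \<and>
            ((j \<le> j' \<and> j' \<le> int u * m - j \<and> even u) \<or>
             (j \<le> j' \<and> j' \<le> int u * m - (m - j) \<and> odd u)) \<longrightarrow>
            b_defined (affine_module.branching_weights scale act u) lam \<and>
            b_defined (affine_module.weights scale act) lam \<and>
            b_number (affine_module.branching_weights scale act u) lam =
              b_number (affine_module.weights scale act) lam)"
proof -
  interpret affine_module scale act by fact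
  have Lam: "Lam $ 1 = of_int m - of_int j" "Lam $ 2 = of_int j" "Lam $ 3 = 0"
    by (simp_all add: assms(2))
  from assms(2,3) obtain m1 j1 b1 where "level_weight (of_int m) j + 0 *s delta = level_weight (of_int m1) j1 + b1 *s delta"
    "0 \<le> j1" "j1 \<le> m1" unfolding P_plus_def by auto
  then have mj: "0 \<le> j" "j \<le> m" unfolding level_weight_eq_iff by auto
  define M where "M = nat m"
  define k where "k = nat j"
  have M: "m = int M" and k: "j = int k" "k \<le> M" using mj by (simp_all add: M_def k_def)
  have K: "act K_elt v = scale (of_nat M) v" for v
    using K_scalar[OF assms(7), of v] by (simp add: Lam M)
  interpret loop_module scale mode_e mode_h mode_f "act d_elt" "of_nat M"
    by (rule loop_module_modes[OF K])
  \<comment> \<open>Since h_0 = K - h_1 and \<open>K\<close> acts by \<open>M\<close>, the h_1-value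
    fixes the h_0-value; this forces m' = m.\<close>
  have wt_iff: "x \<in> weight_space (lam + b *s delta) \<and> x \<noteq> 0 \<longleftrightarrow>
      x \<in> wt_space (of_int j') b \<and> x \<noteq> 0 \<and> m' = of_int m" for x b
  proof -
    have level: "act h0_elt x = scale (of_real m' - of_int j') x \<longleftrightarrow> m' = of_int m"
      if "x \<noteq> 0" "act h1_elt x = scale (of_int j') x"
    proof -
      have "act h0_elt x = scale (of_nat M - of_int j') x"
        using that(2) by (simp add: act_h0 K scale_left_diff_distrib)
      then have "act h0_elt x = scale (of_real m' - of_int j') x \<longleftrightarrow>
          of_nat M - of_int j' = (of_real m' - of_int j' :: complex)"
        using that(1) by simp
      also have "\<dots> \<longleftrightarrow> complex_of_real (of_nat M) = of_real m'"
        by (simp del: of_real_eq_iff)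
      also have "\<dots> \<longleftrightarrow> m' = of_int m"
        unfolding of_real_eq_iff M by auto
      finally show ?thesis .
    qed
    have comp: "(lam + b *s delta) $ 1 = of_real m' - of_int j'" "(lam + b *s delta) $ 2 = of_int j'"
      "(lam + b *s delta) $ 3 = b"
      by (simp_all add: assms(4))
    show ?thesis
      unfolding weight_space_def wt_space_def mode_h_zero mem_Collect_eq comp
      by (cases "x \<noteq> 0 \<and> act h1_elt x = scale (of_int j') x") (use level in auto)
  qed
  obtain v where v: "v \<noteq> 0" "v \<in> weight_space Lam" "\<And>x. x \<in> n_plus 1 \<Longrightarrow> act x v = 0"
    using assms(7) unfolding is_L_def irreducible_highest_weight_def highest_weight_submodule_def
    by blast
  have irr: "U = {0} \<or> U = UNIV" if "submodule 1 U" for U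
    using assms(7) that unfolding is_L_def irreducible_highest_weight_def irreducible_submodule_def
    by blast
  have hw: "irreducible_hw M k v"
    unfolding irreducible_hw_def
  proof (intro conjI allI impI)
    have "(Poly_Mapping.single 0 1, 0, 0, 0, 0) \<in> n_plus 1" "(0, 0, Poly_Mapping.single 1 1, 0, 0) \<in> n_plus 1"
      by (simp_all add: n_plus_def winding_def del: single_one)
    then show "singular v" using v(3) by (simp add: singular_def mode_e_def mode_f_def del: single_one)
    show "v \<in> wt_space (of_nat k) 0"
      using v(2) by (simp add: weight_space_def wt_space_def mode_h_zero Lam k(1))
    fix U assume "stable U"
    then have "winding_stable 1 U" by (simp add: stable_def winding_stable_def)
    then show "U = {0} \<or> U = UNIV" using irr submodule_iff[OF K] by simp
  qed (use k v in simp_all)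
  have weights_iff: "lam + b *s delta \<in> weights \<longleftrightarrow> m' = of_int m \<and> (\<exists>x. x \<noteq> 0 \<and> x \<in> wt_space (of_int j') b)" for b
    using wt_iff[of _ b] by (auto simp: in_weights_iff)
  show ?thesis
  proof (intro conjI[of "_ \<longrightarrow> _"] impI)
    assume "\<exists>b. (Lam, lam + b *s delta) \<in> Gamma u"
    then obtain b where "lam + b *s delta \<in> weights"
      using branching_weights_subset by (auto simp: Gamma_def)
    then obtain x where x: "m' = of_int m" "x \<noteq> 0" "x \<in> wt_space (of_int j') b" using weights_iff by blast
    obtain P where "of_int j' = (of_int P :: complex)" "even (P - int k)"
      by (rule irreducible_hw_wt[OF hw x(2,3)])
    then have "even (j' - j)" unfolding k(1) of_int_eq_iff by simp
    with x(1) show "even (j' - j) \<and> m' = of_int m" by simp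
  next
    assume asm: "even (j' - j) \<and> m' = of_int m \<and>
            ((j \<le> j' \<and> j' \<le> int u * m - j \<and> even u) \<or>
             (j \<le> j' \<and> j' \<le> int u * m - (m - j) \<and> odd u))"
    obtain n where n: "u = Suc n" using assms(1) by (cases u) auto
    \<comment> \<open>The upper bounds in (a) and (b) are the wall of index u - 1, whose parity is
      opposite to that of \<open>u\<close>.\<close>
    have wall: "wall M k (u - 1) = (if even u then int u * m - j else int u * m - (m - j))"
      unfolding n diff_Suc_1 wall_eq[OF k(2)] M k(1) by (simp add: distrib_right)
    have p: "wall M k 0 \<le> j'" "j' \<le> wall M k (u - 1)" "j' \<le> int u * int M" "even (j' - int k)"
    proof -
      show "wall M k 0 \<le> j'" "even (j' - int k)" using asm k(1) by auto
      have "j' \<le> (if even u then int u * m - j else int u * m - (m - j))"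
        using asm by (elim conjE disjE) simp_all
      show "j' \<le> wall M k (u - 1)"
        unfolding wall by fact
      have "j' \<le> int u * m - j \<or> j' \<le> int u * m - (m - j)" using asm by blast
      then have "j' \<le> int u * m" using mj by auto
      show "j' \<le> int u * int M"
        unfolding M[symmetric] by fact
    qed
    obtain N x W where x: "x \<noteq> 0" "x \<in> wt_space (of_int j') (- of_int N)"
      and max: "\<And>y q. y \<noteq> 0 \<Longrightarrow> y \<in> wt_space (of_int j') q \<Longrightarrow> \<exists>N' \<ge> N. q = - of_int N'"
      and sing: "winding_singular u x" and W: "winding_stable u W" "x \<in> W"
      and W_min: "\<And>U. winding_stable u U \<Longrightarrow> x \<in> U \<Longrightarrow> W \<subseteq> U"
      and W_irr: "\<And>U. winding_stable u U \<Longrightarrow> U \<subseteq> W \<Longrightarrow> U = {0} \<or> U = W"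
      by (rule winding_branching[OF hw assms(1) p]) (rule that; assumption)
    have bound: "\<exists>N' \<ge> N. b = - of_int N'" if "lam + b *s delta \<in> weights" for b
      using that max weights_iff by blast
    have in_weights: "lam + (- of_int N) *s delta \<in> weights" using weights_iff asm x by blast
    have "act y x = 0" if y: "y \<in> n_plus u" for y
    proof -
      obtain a b c z s where abc: "y = (a, b, c, z, s)" by (cases y)
      have multiple: "\<exists>k \<ge> i. n = int u * k" if n: "int u dvd n" "n \<ge> i" "i \<in> {0, 1}" for n i
      proof -
        obtain k where k: "n = int u * k" using n(1) by (rule dvdE)
        have "k \<ge> i"
          using n(2,3) assms(1) mult_pos_neg[of "int u" k] mult_nonneg_nonpos[of "int u" k] unfolding k by force
        with k show ?thesis by blast
      qed
      have keys: "n \<in> Poly_Mapping.keys a \<Longrightarrow> int u dvd n \<and> n \<ge> 0"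
        "n \<in> Poly_Mapping.keys b \<Longrightarrow> int u dvd n \<and> n \<ge> 1"
        "n \<in> Poly_Mapping.keys c \<Longrightarrow> int u dvd n \<and> n \<ge> 1" for n
        using y by (auto simp: abc n_plus_def winding_def)
      have "mode_e n x = 0" if "n \<in> Poly_Mapping.keys a" for n
        using sing multiple[of n 0] keys(1)[OF that] unfolding winding_singular_def by blast
      moreover have "mode_h n x = 0" if "n \<in> Poly_Mapping.keys b" for n
        using sing multiple[of n 1] keys(2)[OF that] unfolding winding_singular_def by blast
      moreover have "mode_f n x = 0" if "n \<in> Poly_Mapping.keys c" for n
        using sing multiple[of n 1] keys(3)[OF that] unfolding winding_singular_def by blast
      ultimately have "act (a, b, c, z, s) x \<in> {0}"
        by (intro act_in_subspace) (use y in \<open>auto simp: abc n_plus_def\<close>)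
      then show ?thesis by (simp add: abc)
    qed
    moreover have "x \<in> weight_space (lam + (- of_int N) *s delta)" using wt_iff x asm by blast
    ultimately have "highest_weight_submodule u W (lam + (- of_int N) *s delta)"
      unfolding highest_weight_submodule_def submodule_iff[OF K] using W W_min x(1) by blast
    moreover have "irreducible_submodule u W"
      unfolding irreducible_submodule_def submodule_iff[OF K] using W W_irr x(1) by blast
    moreover have "lam + (- of_int N) *s delta \<in> P_plus_dot u"
    proof -
      obtain m2 j2 b2 where "lam = level_weight m2 j2 + b2 *s delta" "of_nat u * m2 \<in> \<int>" "0 \<le> j2"
        "of_int j2 \<le> of_nat u * m2"
        using assms(5) unfolding P_plus_dot_def by blast
      moreover from this(1) have "lam + (- of_int N) *s delta = level_weight m2 j2 + (b2 - of_int N) *s delta"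
        by (simp add: vector_sadd_rdistrib flip: diff_conv_add_uminus)
      ultimately show ?thesis unfolding P_plus_dot_def by blast
    qed
    ultimately have in_branching: "lam + (- of_int N) *s delta \<in> branching_weights u"
      unfolding branching_weights_def irreducible_highest_weight_def by blast
    \<comment> \<open>The bound for weights also holds for the subset of branching weights, and both
      sets contain \<lambda> - N \<delta>.\<close>
    have "is_b weights lam b \<longleftrightarrow> b = - of_int N" "is_b (branching_weights u) lam b \<longleftrightarrow> b = - of_int N" for b
      using in_weights in_branching bound branching_weights_subset by (intro is_b_iff; blast)+
    then show "b_defined (branching_weights u) lam \<and> b_defined weights lam \<and>
        b_number (branching_weights u) lam = b_number weights lam"
      by (simp add: b_defined_def b_number_def)
  qed
qed

end
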